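(* Let $d\ge 1$, $0\le \alpha<d$, $\nu\ge 1$, $N\in\mathbb{N}$ and $\Lambda_0\in(0,1)$. There is a constant $C>0$, depending only on $d,\alpha,\nu,N,\Lambda_0$, such that the following holds. Let $\phi$ be any Young function with $\lim_{t\to\infty}\phi(t)/t=\infty$, let $\psi$ be its complementary function, and suppose that $$c_\phi:=\sum_{k=1}^\infty \frac{1}{\psi^{-1}(2^{2^k})}<\infty .$$ Then for every dyadic grid $\mathcal{D}$ in $\mathbb{R}^d$, every $N$-regular sparse family of cubes $\mathcal{S}\subset\mathcal{D}$ with sparseness constant $\Lambda_0$, every weight $w$ on $\mathbb{R}^d$, and every nonnegative locally integrable function $f$ on $\mathbb{R}^d$, $$\sup_{\lambda>0}\ \lambda\, w\big(\{x\in\mathbb{R}^d:\ \mathcal{A}^{\mathcal{S}}_{\alpha,\nu}f(x)>\lambda\}\big)\ \le\ C\,c_\phi\int_{\mathbb{R}^d} f(x)\,M_\alpha(M_\phi w)(x)\,dx .$$ That is, $\|\mathcal{A}^{\mathcal{S}}_{\alpha,\nu}f\|_{L^{1,\infty}(w)}\lesssim c_\phi\,\|f\|_{L^1(M_\alpha(M_\phi w))}$.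
   Context: **Weights.** A weight $w$ is a nonnegative locally integrable function on $\mathbb{R}^d$, and $w(E)=\int_E w\,dx$ for measurable $E$. **Young functions.** A Young function is a convex, increasing function $\phi:[0,\infty)\to[0,\infty)$ with $\phi(0)=0$ and $\lim_{t\to\infty}\phi(t)=\infty$. Its complementary function is $\psi(s)=\sup_{t>0}\{st-\phi(t)\}$. When $\lim_{t\to\infty}\phi(t)/t=\infty$, $\psi$ is finite valued and is also a Young function. $\psi^{-1}$ denotes the inverse of $\psi$ on $(0,\infty)$. **Maximal functions.** For a cube $Q$, the Luxemburg average is $\|w\|_{\phi,Q}=\inf\{\lambda>0:\ \frac1{|Q|}\int_Q\phi(|w|/\lambda)\,dx\le 1\}$. Define $M_\phi w(x)=M_{\phi(L)}w(x)=\sup_{Q\ni x}\|w\|_{\phi,Q}$ and $M_\alpha g(x)=\sup_{Q\ni x}|Q|^{\frac{\alpha}{d}-1}\int_Q|g|\,dy$. Both suprema are over all cubes $Q\subset\mathbb{R}^d$ with sides parallel to the axes containing $x$. **Dyadic grid.** A dyadic grid $\mathcal{D}$ is a collection of cubes in $\mathbb{R}^d$ such that: - each $Q\in\mathcal{D}$ has $|Q|=2^{kd}$ for some $k\in\mathbb{Z}$; - for $P,Q\in\mathcal{D}$, $P\cap Q\in\{P,Q,\varnothing\}$; - for each $k\in\mathbb{Z}$, the cubes $Q\in\mathcal{D}$ with $|Q|=2^{kd}$ form a partition of $\mathbb{R}^d$. **Sparse families.** A family $\mathcal{S}\subset\mathcal{D}$ is sparse with sparseness constant $\Lambda_0\in(0,1)$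 if for every $Q\in\mathcal{S}$, $$\Big|\bigcup_{P\in\mathcal{S},\,P\subsetneq Q}P\Big|\le \Lambda_0|Q|.$$ **$N$-regularity.** For $Q\in\mathcal{S}$, $\mathrm{Ch}_{\mathcal{S}}(Q)$ is the set of children (immediate successors) of $Q$ in $\mathcal{S}$, i.e. the maximal elements of $\{P\in\mathcal{S}: P\subsetneq Q\}$ with respect to inclusion. A sparse family $\mathcal{S}$ is $N$-regular if $\#\mathrm{Ch}_{\mathcal{S}}(Q)\le N$ for all $Q\in\mathcal{S}$. **Fractional sparse operator.** For nonnegative locally integrable $f$, with $\langle f\rangle_{\alpha,Q}:=|Q|^{\frac{\alpha}{d}-1}\int_Q f(x)\,dx$, $$\mathcal{A}^{\mathcal{S}}_{\alpha,\nu}f(x):=\Big(\sum_{Q\in\mathcal{S}}\langle f\rangle_{\alpha,Q}^{\nu}\,\chi_Q(x)\Big)^{1/\nu}.$$ *)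

theory Defs
  imports "HOL-Analysis.Analysis"
begin

text \<open>Conventions. The Euclidean space of dimension d is \<open>real ^ 'n\<close> with \<open>d = CARD('n)\<close>, with
  Lebesgue measure on the Lebesgue measurable sets. Quantities that may be infinite take
  values in \<open>ennreal\<close>, where \<open>0 * \<infinity> = 0\<close>.\<close>

text \<open>Weights, and also the functions the operator acts on.\<close>

definition nonneg_loc_integrable :: "(real ^ 'n \<Rightarrow> real) \<Rightarrow> bool" where
  "nonneg_loc_integrable w \<longleftrightarrow>
     (\<forall>x. 0 \<le> w x) \<and> (\<forall>K. compact K \<longrightarrow> w absolutely_integrable_on K)"

definition weight_of :: "(real ^ 'n \<Rightarrow> real) \<Rightarrow> (real ^ 'n) set \<Rightarrow> ennreal" where
  "weight_of w E = (\<integral>\<^sup>+x\<in>E. ennreal (w x) \<partial>lebesgue)"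

text \<open>A Young function is a function on \<open>{0..}\<close>; its values at negative arguments play no role.
  ``Increasing'' is meant in the weak sense: the complementary function of a Young function
  may vanish on an initial interval, and is to be a Young function again.\<close>

definition young_function :: "(real \<Rightarrow> real) \<Rightarrow> bool" where
  "young_function \<phi> \<longleftrightarrow>
     \<phi> \<in> {0..} \<rightarrow> {0..} \<and> convex_on {0..} \<phi> \<and> mono_on {0..} \<phi> \<and> \<phi> 0 = 0 \<and>
     filterlim \<phi> at_top at_top"

text \<open>The supremum is a real one; it is meaningful (bounded above) when \<open>\<phi> t / t\<close> tends to
  infinity.\<close>

definition complementary :: "(real \<Rightarrow> real) \<Rightarrow> real \<Rightarrow> real" where
  "complementary \<phi> s = (SUP t\<in>{0<..}. s * t - \<phi> t)"

text \<open>A Young function may vanish on an initial interval, but it is a bijection from the set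
  where it is positive onto \<open>{0<..}\<close>. Hence, for \<open>y > 0\<close>, there is exactly one \<open>s > 0\<close> with
  \<open>\<psi> s = y\<close>, and this is the value below.\<close>

definition young_inv :: "(real \<Rightarrow> real) \<Rightarrow> real \<Rightarrow> real" where
  "young_inv \<psi> y = inv_into {0<..} \<psi> y"

text \<open>The \<open>k\<close>-th term of the series defining \<open>c\<^sub>\<phi>\<close>, which runs over \<open>k \<ge> 1\<close>.\<close>

definition c_young_term :: "(real \<Rightarrow> real) \<Rightarrow> nat \<Rightarrow> real" where
  "c_young_term \<phi> k = 1 / young_inv (complementary \<phi>) (2 ^ (2 ^ k))"

definition c_young :: "(real \<Rightarrow> real) \<Rightarrow> real" where
  "c_young \<phi> = (\<Sum>k. c_young_term \<phi> (Suc k))"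

text \<open>A cube is a product of bounded intervals of the same length \<open>l > 0\<close>, each of which may be
  open, closed or half-open (the two inclusions leave exactly these possibilities).\<close>

definition cube :: "(real ^ 'n) set \<Rightarrow> bool" where
  "cube Q \<longleftrightarrow> (\<exists>a l I. 0 < l \<and>
     (\<forall>i. {a $ i <..< a $ i + l} \<subseteq> I i \<and> I i \<subseteq> {a $ i .. a $ i + l}) \<and>
     Q = {x. \<forall>i. x $ i \<in> I i})"

definition luxemburg :: "(real \<Rightarrow> real) \<Rightarrow> (real ^ 'n \<Rightarrow> real) \<Rightarrow> (real ^ 'n) set \<Rightarrow> ennreal" where
  "luxemburg \<phi> w Q = Inf {ennreal r | r. 0 < r \<and>
     (\<integral>\<^sup>+x\<in>Q. ennreal (\<phi> (\<bar>w x\<bar> / r)) \<partial>lebesgue) / emeasure lebesgue Q \<le> 1}"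

definition maximal_young :: "(real \<Rightarrow> real) \<Rightarrow> (real ^ 'n \<Rightarrow> real) \<Rightarrow> real ^ 'n \<Rightarrow> ennreal" where
  "maximal_young \<phi> w x = (SUP Q\<in>{Q. cube Q \<and> x \<in> Q}. luxemburg \<phi> w Q)"

definition frac_average :: "real \<Rightarrow> (real ^ 'n \<Rightarrow> ennreal) \<Rightarrow> (real ^ 'n) set \<Rightarrow> ennreal" where
  "frac_average \<alpha> g Q =
     ennreal (measure lebesgue Q powr (\<alpha> / real CARD('n) - 1)) * (\<integral>\<^sup>+x\<in>Q. g x \<partial>lebesgue)"

definition frac_maximal :: "real \<Rightarrow> (real ^ 'n \<Rightarrow> ennreal) \<Rightarrow> real ^ 'n \<Rightarrow> ennreal" where
  "frac_maximal \<alpha> g x = (SUP Q\<in>{Q. cube Q \<and> x \<in> Q}. frac_average \<alpha> g Q)"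

definition dyadic_grid :: "(real ^ 'n) set set \<Rightarrow> bool" where
  "dyadic_grid D \<longleftrightarrow>
     (\<forall>Q\<in>D. cube Q \<and> (\<exists>k::int. measure lebesgue Q = 2 powi (k * int CARD('n)))) \<and>
     (\<forall>P\<in>D. \<forall>Q\<in>D. P \<inter> Q \<in> {P, Q, {}}) \<and>
     (\<forall>k::int. partition_on UNIV {Q\<in>D. measure lebesgue Q = 2 powi (k * int CARD('n))})"

definition sparse_family :: "real \<Rightarrow> (real ^ 'n) set set \<Rightarrow> bool" where
  "sparse_family \<Lambda> S \<longleftrightarrow>
     (\<forall>Q\<in>S. emeasure lebesgue (\<Union>{P\<in>S. P \<subset> Q}) \<le> ennreal \<Lambda> * emeasure lebesgue Q)"

definition children :: "(real ^ 'n) set set \<Rightarrow> (real ^ 'n) set \<Rightarrow> (real ^ 'n) set set" where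
  "children S Q = {P\<in>S. P \<subset> Q \<and> \<not> (\<exists>R\<in>S. P \<subset> R \<and> R \<subset> Q)}"

definition regular_family :: "nat \<Rightarrow> (real ^ 'n) set set \<Rightarrow> bool" where
  "regular_family N S \<longleftrightarrow> (\<forall>Q\<in>S. finite (children S Q) \<and> card (children S Q) \<le> N)"

text \<open>Powers of elements of \<open>[0, \<infinity>]\<close> with a positive exponent.\<close>

definition ennreal_power :: "ennreal \<Rightarrow> real \<Rightarrow> ennreal" where
  "ennreal_power u p = (if u = \<infinity> then \<infinity> else ennreal (enn2real u powr p))"

definition sparse_operator ::
  "real \<Rightarrow> real \<Rightarrow> (real ^ 'n) set set \<Rightarrow> (real ^ 'n \<Rightarrow> real) \<Rightarrow> real ^ 'n \<Rightarrow> ennreal" where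
  "sparse_operator \<alpha> \<nu> S f x =
     ennreal_power
       (\<Sum>\<^sub>\<infinity>Q\<in>S. ennreal_power (frac_average \<alpha> (\<lambda>y. ennreal (f y)) Q) \<nu> * indicator Q x)
       (1 / \<nu>)"

end

theory Submission
  imports Defs
begin

text \<open>
  Write \<open>a\<^sub>Q\<close> for the fractional average of \<open>f\<close> over \<open>Q\<close>, \<open>L\<^sub>Q\<close> for the Luxemburg average of \<open>w\<close>
  over \<open>Q\<close>, and \<open>I\<close> for the integral of \<open>f\<close> against \<open>M\<^sub>\<alpha> (M\<^sub>\<phi> w)\<close>. Since the \<open>\<nu>\<close>-norm of a sequence is
  at most its sum, and since \<open>S\<close> is countable, it suffices to bound the measure \<open>w\<close> of the set where
  the sum of \<open>a\<^sub>Q \<chi>\<^sub>Q\<close> over a finite subfamily of \<open>S\<close> exceeds \<open>r\<close>, uniformly in the subfamily.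

  Two estimates carry the proof. The first concerns a family \<open>T\<close> on which all averages
  \<open>a\<^sub>Q\<close> are at least \<open>b\<close> (\<open>sum_luxemburg_le_integral\<close>):
  the sum of \<open>|Q| L\<^sub>Q\<close> over \<open>T\<close> is at most \<open>I / ((1 - \<Lambda>) b)\<close>. By sparseness \<open>Q\<close> has a part of measure at
  least \<open>(1 - \<Lambda>) |Q|\<close> outside the smaller members of \<open>T\<close>; these parts are disjoint and \<open>M\<^sub>\<phi> w \<ge> L\<^sub>Q\<close>
  on \<open>Q\<close>, so the sum is at most \<open>1 / (1 - \<Lambda>)\<close> times the integral of \<open>M\<^sub>\<phi> w\<close> over the maximal cubes of
  \<open>T\<close>. On a maximal cube \<open>b\<close> may be replaced by \<open>a\<^sub>Q\<close>, and the scaling factor of \<open>a\<^sub>Q\<close> moved from \<open>f\<close> to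
  \<open>M\<^sub>\<phi> w\<close>: then \<open>a\<^sub>Q\<close> times the integral of \<open>M\<^sub>\<phi> w\<close> over \<open>Q\<close> is the integral of \<open>f\<close> over \<open>Q\<close> times the
  fractional average of \<open>M\<^sub>\<phi> w\<close>, which \<open>M\<^sub>\<alpha> (M\<^sub>\<phi> w)\<close> dominates on \<open>Q\<close>.

  The second (\<open>weight_le_luxemburg\<close>) is a form of Hoelder's inequality: a subset \<open>E\<close> of \<open>Q\<close> with
  \<open>|E| \<le> |Q| / y\<close> has \<open>w(E) \<le> 2 |Q| L\<^sub>Q / \<psi>\<^sup>-\<^sup>1(y)\<close>.

  Choose \<open>m\<close> with \<open>\<Lambda>\<^sup>m \<le> 1/2\<close>, and \<open>j0\<close> large. The cubes with \<open>a\<^sub>Q > r / 4^j0\<close> are treated directly: their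
  union has \<open>w\<close>-measure at most a multiple of the sum of \<open>|Q| L\<^sub>Q\<close>. The others are sorted into levels
  \<open>T\<^sub>j\<close>, \<open>j \<ge> j0\<close>, where \<open>a\<^sub>Q\<close> lies between \<open>r / 4^(j+1)\<close> and \<open>r / 4^j\<close>. In \<open>Q \<in> T\<^sub>j\<close> the deep part is the
  set of points covered by more than \<open>m 2^j\<close> cubes of \<open>T\<^sub>j\<close> contained in \<open>Q\<close>.
  A point lies in at most \<open>m 2^j\<close> cubes of \<open>T\<^sub>j\<close> without being deep in them
  (\<open>card_not_deep_le\<close>), so these cubes contribute at most \<open>r m / 2^j\<close> to the sum at that point, and
  all levels together at most \<open>r / 2\<close>. Hence the deep parts have to contribute more than \<open>r / 2\<close>, and
  Chebyshev's inequality leaves the sum of \<open>a\<^sub>Q w(deep part of Q)\<close>. By sparseness the deep part has measure at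
  most \<open>\<Lambda>^(m 2^j) |Q| \<le> |Q| / 2^(2^j)\<close> (\<open>emeasure_deep_le\<close>), so that the two estimates bound level \<open>j\<close> by a
  multiple of \<open>I / \<psi>\<^sup>-\<^sup>1(2^(2^j))\<close>. Summation over \<open>j\<close> produces \<open>c\<^sub>\<phi> I\<close>. The levels have ratio \<open>4\<close>
  instead of \<open>2\<close> exactly to make the contributions \<open>m 2^j / 4^j\<close> of the non-deep parts summable.
\<close>

section \<open>Cubes\<close>

lemma cube_between_boxes:
  fixes Q :: "(real ^ 'n) set"
  assumes "cube Q"
  obtains a b where "box a b \<subseteq> Q" "Q \<subseteq> cbox a b" "box a b \<noteq> {}"
proof -
  from assms obtain a :: "real ^ 'n" and l I where l: "0 < l"
    and I: "\<And>i. {a $ i <..< a $ i + l} \<subseteq> I i \<and> I i \<subseteq> {a $ i .. a $ i + l}"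
    and Q: "Q = {x. \<forall>i. x $ i \<in> I i}"
    unfolding cube_def by blast
  define b where "b = a + (\<chi> i. l)"
  have b: "b $ i = a $ i + l" for i by (simp add: b_def)
  show ?thesis
  proof
    show "box a b \<subseteq> Q"
      unfolding Q using I by (fastforce simp: mem_box_cart b)
    show "Q \<subseteq> cbox a b"
      unfolding Q using I by (fastforce simp: mem_box_cart b)
    have "a + (\<chi> i. l / 2) \<in> box a b"
      using l by (simp add: mem_box_cart b)
    then show "box a b \<noteq> {}" by blast
  qed
qed

lemma cube_lmeasurable:
  fixes Q :: "(real ^ 'n) set"
  assumes "cube Q"
  shows "Q \<in> lmeasurable"
proof -
  obtain a b where *: "box a b \<subseteq> Q" "Q \<subseteq> cbox a b"
    using cube_between_boxes[OF assms] by metis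
  have "negligible (Q - box a b)"
    by (rule negligible_subset[OF negligible_frontier_interval]) (use * in blast)
  then have "Q - box a b \<in> lmeasurable" by (rule negligible_imp_measurable)
  then have "box a b \<union> (Q - box a b) \<in> lmeasurable"
    by (intro fmeasurable.Un) auto
  moreover have "box a b \<union> (Q - box a b) = Q" using * by blast
  ultimately show ?thesis by simp
qed

lemma cube_sets: "cube Q \<Longrightarrow> Q \<in> sets lebesgue"
  using cube_lmeasurable by (rule fmeasurableD)

lemma cube_emeasure: "cube Q \<Longrightarrow> emeasure lebesgue Q = ennreal (measure lebesgue Q)"
  by (simp add: cube_lmeasurable emeasure_eq_measure2)

lemma cube_interior_nonempty:
  fixes Q :: "(real ^ 'n) set"
  assumes "cube Q" shows "interior Q \<noteq> {}"
proof -
  obtain a b where *: "box a b \<subseteq> Q" "box a b \<noteq> {}"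
    using cube_between_boxes[OF assms] by metis
  then have "box a b \<subseteq> interior Q" using interior_maximal[OF _ open_box] by blast
  with * show ?thesis by blast
qed

lemma cube_measure_pos:
  fixes Q :: "(real ^ 'n) set"
  assumes "cube Q" shows "0 < measure lebesgue Q"
proof -
  have "\<not> negligible Q"
    using open_not_negligible[OF open_interior cube_interior_nonempty[OF assms]]
      negligible_subset interior_subset by blast
  then have "measure lebesgue Q \<noteq> 0"
    using cube_lmeasurable[OF assms] negligible_iff_measure by blast
  then show ?thesis by (simp add: zero_less_measure_iff)
qed

lemma cube_integral_finite:
  fixes f :: "real ^ 'n \<Rightarrow> real"
  assumes "nonneg_loc_integrable f" and "cube Q"
  shows "(\<integral>\<^sup>+x\<in>Q. ennreal (f x) \<partial>lebesgue) < \<infinity>"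
proof -
  obtain a b where "Q \<subseteq> cbox a b" using cube_between_boxes[OF assms(2)] by metis
  then have "f absolutely_integrable_on Q"
    using assms set_integrable_subset[of lebesgue "cbox a b" f Q] cube_sets[OF assms(2)]
    unfolding nonneg_loc_integrable_def by (auto simp: compact_cbox)
  then have "integrable lebesgue (\<lambda>x. indicat_real Q x *\<^sub>R f x)"
    by (simp add: set_integrable_def)
  then have "(\<integral>\<^sup>+x. ennreal (norm (indicat_real Q x *\<^sub>R f x)) \<partial>lebesgue) < \<infinity>"
    by (simp add: integrable_iff_bounded)
  also have "(\<integral>\<^sup>+x. ennreal (norm (indicat_real Q x *\<^sub>R f x)) \<partial>lebesgue)
      = (\<integral>\<^sup>+x\<in>Q. ennreal (f x) \<partial>lebesgue)"
    using assms(1) unfolding nonneg_loc_integrable_def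
    by (intro nn_integral_cong) (auto simp: indicator_def)
  finally show ?thesis .
qed

lemma loc_integrable_measurable:
  fixes f :: "real ^ 'n \<Rightarrow> real"
  assumes "nonneg_loc_integrable f"
  shows "f \<in> borel_measurable lebesgue"
proof (rule borel_measurable_LIMSEQ_real)
  fix n :: nat
  have "f absolutely_integrable_on (cball 0 (real n))"
    using assms unfolding nonneg_loc_integrable_def by auto
  then show "(\<lambda>x. indicat_real (cball 0 (real n)) x *\<^sub>R f x) \<in> borel_measurable lebesgue"
    by (simp add: set_integrable_def borel_measurable_integrable)
next
  fix x :: "real ^ 'n"
  have "\<forall>\<^sub>F n in sequentially. norm x \<le> real n"
    using eventually_ge_at_top[of "nat \<lceil>norm x\<rceil>"]
    by eventually_elim linarith
  then have "\<forall>\<^sub>F n in sequentially. indicat_real (cball 0 (real n)) x *\<^sub>R f x = f x"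
    by eventually_elim (auto simp: indicator_def)
  then show "(\<lambda>n. indicat_real (cball 0 (real n)) x *\<^sub>R f x) \<longlonglongrightarrow> f x"
    by (rule tendsto_eventually)
qed

section \<open>The complementary function\<close>

lemma complementary_bdd_above:
  assumes "young_function \<phi>" and "filterlim (\<lambda>t. \<phi> t / t) at_top at_top"
  shows "bdd_above ((\<lambda>t. s * t - \<phi> t) ` {0<..})"
proof -
  have "\<forall>\<^sub>F t in at_top. s \<le> \<phi> t / t"
    using assms(2) by (simp add: filterlim_at_top)
  then obtain T where T: "\<And>t. T \<le> t \<Longrightarrow> s \<le> \<phi> t / t"
    by (auto simp: eventually_at_top_linorder)
  have "s * t - \<phi> t \<le> \<bar>s\<bar> * \<bar>T\<bar>" if "0 < t" for t
  proof (cases "T \<le> t")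
    case True
    then have "s * t - \<phi> t \<le> 0" using T[OF True] that by (simp add: field_simps)
    also have "0 \<le> \<bar>s\<bar> * \<bar>T\<bar>" by simp
    finally show ?thesis .
  next
    case False
    have "0 \<le> \<phi> t" using assms(1) that by (auto simp: young_function_def)
    moreover have "s * t \<le> \<bar>s\<bar> * \<bar>T\<bar>"
    proof -
      have "s * t \<le> \<bar>s\<bar> * t" using that by (intro mult_right_mono) auto
      also have "\<dots> \<le> \<bar>s\<bar> * \<bar>T\<bar>" using False by (intro mult_left_mono) auto
      finally show ?thesis .
    qed
    ultimately show ?thesis by linarith
  qed
  then show ?thesis by (intro bdd_aboveI2[where M = "\<bar>s\<bar> * \<bar>T\<bar>"]) simp
qed

lemma young_inequality:
  assumes "young_function \<phi>" and "filterlim (\<lambda>t. \<phi> t / t) at_top at_top" and "0 < t"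
  shows "s * t \<le> \<phi> t + complementary \<phi> s"
  using cSUP_upper[OF _ complementary_bdd_above[OF assms(1,2)], of t s] assms(3)
  unfolding complementary_def by simp

text \<open>As a pointwise supremum of affine functions, \<open>complementary \<phi>\<close> is convex, hence continuous, on
  the whole line; the intermediate value theorem then provides the inverse.\<close>

lemma complementary_continuous:
  assumes "young_function \<phi>" and "filterlim (\<lambda>t. \<phi> t / t) at_top at_top"
  shows "continuous_on UNIV (complementary \<phi>)"
proof (rule convex_on_continuous)
  show "convex_on UNIV (complementary \<phi>)"
  proof (rule convex_onI)
    fix u x y :: real assume u: "0 < u" "u < 1"
    let ?z = "(1 - u) *\<^sub>R x + u *\<^sub>R y"
    have "?z * t - \<phi> t \<le> (1 - u) * complementary \<phi> x + u * complementary \<phi> y"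
      if "t \<in> {0<..}" for t
    proof -
      have "(1 - u) * (x * t - \<phi> t) \<le> (1 - u) * complementary \<phi> x"
        using young_inequality[OF assms, of t x] that u by (intro mult_left_mono) auto
      moreover have "u * (y * t - \<phi> t) \<le> u * complementary \<phi> y"
        using young_inequality[OF assms, of t y] that u by (intro mult_left_mono) auto
      moreover have "?z * t - \<phi> t = (1 - u) * (x * t - \<phi> t) + u * (y * t - \<phi> t)"
        by (simp add: algebra_simps)
      ultimately show ?thesis by linarith
    qed
    then show "complementary \<phi> ?z \<le> (1 - u) * complementary \<phi> x + u * complementary \<phi> y"
      unfolding complementary_def[of \<phi> ?z] by (intro cSUP_least) auto
  qed simp
qed simp

lemma young_inv_complementary:
  assumes \<phi>: "young_function \<phi>" "filterlim (\<lambda>t. \<phi> t / t) at_top at_top" and "0 < y"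
  shows "0 < young_inv (complementary \<phi>) y"
    and "complementary \<phi> (young_inv (complementary \<phi>) y) = y"
proof -
  let ?\<psi> = "complementary \<phi>"
  have \<phi>1: "0 \<le> \<phi> 1" using \<phi>(1) by (auto simp: young_function_def)
  have 0: "?\<psi> 0 \<le> 0"
    unfolding complementary_def using \<phi>(1)
    by (intro cSUP_least) (auto simp: young_function_def)
  have "(y + \<phi> 1) * 1 \<le> \<phi> 1 + ?\<psi> (y + \<phi> 1)"
    by (rule young_inequality[OF \<phi>]) simp
  then have 1: "y \<le> ?\<psi> (y + \<phi> 1)" by simp
  have "\<exists>s\<ge>0. s \<le> y + \<phi> 1 \<and> ?\<psi> s = y"
    using 0 1 \<open>0 < y\<close> \<phi>1 complementary_continuous[OF \<phi>]
    by (intro IVT') (auto intro: continuous_on_subset)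
  then obtain s where s: "0 \<le> s" "?\<psi> s = y" by blast
  with 0 \<open>0 < y\<close> have "s \<noteq> 0" by auto
  with s have "y \<in> ?\<psi> ` {0<..}" by auto
  then show "0 < young_inv ?\<psi> y" "?\<psi> (young_inv ?\<psi> y) = y"
    using inv_into_into[of y ?\<psi> "{0<..}"] f_inv_into_f[of y ?\<psi> "{0<..}"]
    by (auto simp: young_inv_def)
qed

lemma young_function_borel:
  assumes "young_function \<phi>"
  shows "(\<lambda>t. \<phi> \<bar>t\<bar>) \<in> borel_measurable borel"
proof -
  have "mono (\<lambda>t. \<phi> (max 0 t))"
    using assms by (auto simp: young_function_def mono_on_def intro!: monoI)
  then have "(\<lambda>t. \<phi> (max 0 t)) \<in> borel_measurable borel"
    by (rule borel_measurable_mono)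
  then have "(\<lambda>t. \<phi> (max 0 \<bar>t\<bar>)) \<in> borel_measurable borel"
    by measurable
  then show ?thesis by (simp add: max_def)
qed

section \<open>Weights of small subsets of a cube\<close>

text \<open>Young's inequality for the product of \<open>w / r\<close> and \<open>s\<close>, integrated over \<open>E\<close>, bounds \<open>s w(E) / r\<close> by
  the integral of \<open>\<phi> (w / r)\<close>, which is at most \<open>|Q|\<close> for admissible \<open>r\<close>, plus \<open>\<psi>(s) |E|\<close>. The case
  \<open>K = 1\<close> is used for small subsets, and \<open>E = Q\<close>, \<open>K = \<psi>(s)\<close> for whole cubes.\<close>

lemma weight_le_luxemburg:
  fixes w :: "real ^ 'n \<Rightarrow> real"
  assumes \<phi>: "young_function \<phi>" "filterlim (\<lambda>t. \<phi> t / t) at_top at_top"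
    and w: "nonneg_loc_integrable w" and Q: "cube Q"
    and E [measurable]: "E \<in> sets lebesgue" and "E \<subseteq> Q"
    and s: "0 < s" "0 \<le> complementary \<phi> s" and "0 \<le> K"
    and EQ: "ennreal (complementary \<phi> s) * emeasure lebesgue E \<le> ennreal K * emeasure lebesgue Q"
  shows "weight_of w E \<le> ennreal ((1 + K) / s) * (emeasure lebesgue Q * luxemburg \<phi> w Q)"
proof -
  define c where "c = ennreal ((1 + K) / s) * emeasure lebesgue Q"
  have c: "c \<noteq> 0" "c \<noteq> top"
    using s \<open>0 \<le> K\<close> cube_measure_pos[OF Q]
    by (auto simp: c_def cube_emeasure[OF Q] ennreal_mult_eq_top_iff)
  note [measurable] = cube_sets[OF Q] loc_integrable_measurable[OF w] young_function_borel[OF \<phi>(1)]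
  have *: "weight_of w E \<le> ennreal r * c"
    if r: "0 < r" "(\<integral>\<^sup>+x\<in>Q. ennreal (\<phi> (\<bar>w x\<bar> / r)) \<partial>lebesgue) / emeasure lebesgue Q \<le> 1" for r
  proof -
    let ?\<Phi> = "\<lambda>x. ennreal (\<phi> (\<bar>w x\<bar> / r))"
    have meas [measurable]: "?\<Phi> \<in> borel_measurable lebesgue"
      using measurable_compose[OF borel_measurable_divide[OF loc_integrable_measurable[OF w]
            borel_measurable_const[of r]] young_function_borel[OF \<phi>(1)]] r(1)
      by (intro measurable_compose[OF _ measurable_ennreal]) (simp add: abs_divide)
    have "(\<integral>\<^sup>+x\<in>Q. ?\<Phi> x \<partial>lebesgue)
        = (\<integral>\<^sup>+x\<in>Q. ?\<Phi> x \<partial>lebesgue) / emeasure lebesgue Q * emeasure lebesgue Q"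
      using cube_measure_pos[OF Q]
      by (simp add: cube_emeasure[OF Q] ennreal_divide_times mult_divide_eq_ennreal
          flip: ennreal_times_divide)
    also have "\<dots> \<le> 1 * emeasure lebesgue Q"
      by (rule mult_right_mono[OF r(2)]) simp
    finally have \<Phi>Q: "(\<integral>\<^sup>+x\<in>Q. ?\<Phi> x \<partial>lebesgue) \<le> emeasure lebesgue Q" by simp
    have point: "w x \<le> r / s * (\<phi> (\<bar>w x\<bar> / r) + complementary \<phi> s)" for x
    proof (cases "w x = 0")
      case True
      then show ?thesis using r(1) s \<phi>(1) by (simp add: young_function_def)
    next
      case False
      then have "0 < w x" using w by (simp add: nonneg_loc_integrable_def less_le)
      then have "s * (w x / r) \<le> \<phi> (\<bar>w x\<bar> / r) + complementary \<phi> s"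
        using young_inequality[OF \<phi>, of "w x / r" s] r(1) by simp
      then show ?thesis using r(1) s(1) by (simp add: field_simps)
    qed
    have \<phi>0: "0 \<le> \<phi> (\<bar>w x\<bar> / r)" for x
      using \<phi>(1) r(1) by (auto simp: young_function_def)
    have "weight_of w E \<le> (\<integral>\<^sup>+x. ennreal (r / s) *
        (?\<Phi> x * indicator Q x + ennreal (complementary \<phi> s) * indicator E x) \<partial>lebesgue)"
      unfolding weight_of_def
    proof (rule nn_integral_mono)
      fix x
      show "ennreal (w x) * indicator E x \<le> ennreal (r / s) *
        (?\<Phi> x * indicator Q x + ennreal (complementary \<phi> s) * indicator E x)"
        using point[of x] \<phi>0[of x] s r(1) \<open>E \<subseteq> Q\<close>
        by (cases "x \<in> E")
          (auto simp: subset_iff ennreal_leI simp flip: ennreal_plus ennreal_mult)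
    qed
    also have "\<dots> = ennreal (r / s) *
        ((\<integral>\<^sup>+x\<in>Q. ?\<Phi> x \<partial>lebesgue) + ennreal (complementary \<phi> s) * emeasure lebesgue E)"
      by (simp add: nn_integral_cmult nn_integral_add)
    also have "\<dots> \<le> ennreal (r / s) * (emeasure lebesgue Q + ennreal K * emeasure lebesgue Q)"
      by (intro mult_left_mono add_mono \<Phi>Q EQ) simp
    also have "\<dots> = ennreal r * c"
      using r(1) s(1) \<open>0 \<le> K\<close> by (simp add: c_def cube_emeasure[OF Q] field_simps
          flip: ennreal_plus ennreal_mult)
    finally show ?thesis .
  qed
  have "weight_of w E / c \<le> luxemburg \<phi> w Q"
    unfolding luxemburg_def
  proof (rule Inf_greatest, safe)
    fix r :: real
    assume "0 < r" "(\<integral>\<^sup>+x\<in>Q. ennreal (\<phi> (\<bar>w x\<bar> / r)) \<partial>lebesgue) / emeasure lebesgue Q \<le> 1"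
    then have "weight_of w E \<le> ennreal r * c" by (rule *)
    then show "weight_of w E / c \<le> ennreal r"
      using c by (intro divide_le_posI_ennreal) (simp_all add: zero_less_iff_neq_zero mult.commute)
  qed
  then have "weight_of w E / c * c \<le> luxemburg \<phi> w Q * c"
    by (rule mult_right_mono) simp
  moreover have "weight_of w E / c * c = weight_of w E"
    using c by (simp add: ennreal_divide_times ennreal_divide_self less_top zero_less_iff_neq_zero)
  ultimately show ?thesis by (simp add: c_def mult_ac)
qed

section \<open>Finite laminar families\<close>

text \<open>In a laminar family the members containing a given point form a chain. This is the only property of
  dyadic cubes that the counting arguments use.\<close>

definition laminar :: "'a set set \<Rightarrow> bool" where
  "laminar T \<longleftrightarrow> (\<forall>P\<in>T. \<forall>Q\<in>T. P \<inter> Q \<in> {P, Q, {}})"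

definition tops :: "'a set set \<Rightarrow> 'a set set" where
  "tops T = {Q\<in>T. \<not> (\<exists>R\<in>T. Q \<subset> R)}"

lemma laminar_subset: "laminar T \<Longrightarrow> T' \<subseteq> T \<Longrightarrow> laminar T'"
  unfolding laminar_def by blast

lemma laminar_comparable:
  "laminar T \<Longrightarrow> P \<in> T \<Longrightarrow> Q \<in> T \<Longrightarrow> x \<in> P \<Longrightarrow> x \<in> Q \<Longrightarrow> P \<subseteq> Q \<or> Q \<subseteq> P"
  unfolding laminar_def by blast

lemma tops_subset: "tops T \<subseteq> T"
  by (auto simp: tops_def)

lemma tops_above:
  assumes "finite T" "Q \<in> T"
  obtains R where "R \<in> tops T" "Q \<subseteq> R"
  using finite_has_maximal2[OF assms] unfolding tops_def by blast

lemma tops_disjoint: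
  assumes "laminar T" "P \<in> tops T" "Q \<in> tops T" "x \<in> P" "x \<in> Q"
  shows "P = Q"
  using laminar_comparable[OF assms(1), of P Q x] assms unfolding tops_def by blast

lemma emeasure_Union_tops:
  assumes "finite T" "laminar T" "T \<subseteq> sets M"
  shows "(\<Sum>P\<in>tops T. emeasure M P) = emeasure M (\<Union>T)"
proof -
  have "(\<Sum>P\<in>tops T. emeasure M P) = emeasure M (\<Union>P\<in>tops T. P)"
    using assms tops_subset[of T]
    by (intro sum_emeasure) (auto simp: disjoint_family_on_def finite_subset dest: tops_disjoint)
  also have "(\<Union>P\<in>tops T. P) = \<Union>T"
    using tops_subset[of T] by (auto elim!: tops_above[OF assms(1)])
  finally show ?thesis .
qed

text \<open>The points of \<open>Q\<close> that lie in more than \<open>u\<close> members of \<open>T\<close> contained in \<open>Q\<close>, with \<open>Q\<close> itself counted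
  if it belongs to \<open>T\<close>: equivalently, for \<open>Q\<close> in a finite laminar \<open>T\<close>, the union of the
  descendants of \<open>Q\<close> in the \<open>u\<close>-th generation. Counting makes iterated
  generations unnecessary.\<close>

definition deep :: "'a set set \<Rightarrow> nat \<Rightarrow> 'a set \<Rightarrow> 'a set" where
  "deep T u Q = {x\<in>Q. u < card {P\<in>T. x \<in> P \<and> P \<subseteq> Q}}"

lemma deep_sets:
  assumes "finite T" "T \<subseteq> sets M" "Q \<in> sets M"
  shows "deep T u Q \<in> sets M"
proof -
  have eq: "real (card {P\<in>T. x \<in> P \<and> P \<subseteq> Q}) = (\<Sum>P\<in>{P\<in>T. P \<subseteq> Q}. indicat_real P x)" for x
  proof -
    have "(\<Sum>P\<in>{P\<in>T. P \<subseteq> Q}. indicat_real P x) = (\<Sum>P\<in>{P\<in>T. x \<in> P \<and> P \<subseteq> Q}. 1)"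
      using assms(1) by (intro sum.mono_neutral_cong_right) (auto simp: indicator_def)
    then show ?thesis by simp
  qed
  have meas: "(\<lambda>x. \<Sum>P\<in>{P\<in>T. P \<subseteq> Q}. indicat_real P x) \<in> borel_measurable M"
    using assms(2) by (intro borel_measurable_sum borel_measurable_indicator) auto
  have "deep T u Q = Q \<inter> {x\<in>space M. real u < (\<Sum>P\<in>{P\<in>T. P \<subseteq> Q}. indicat_real P x)}"
    unfolding eq[symmetric] deep_def using sets.sets_into_space[OF assms(3)] by auto
  also have "\<dots> \<in> sets M"
    using meas assms(3) unfolding borel_measurable_iff_greater by blast
  finally show ?thesis .
qed

text \<open>The members of \<open>T\<close> that contain \<open>x\<close> and lie properly inside \<open>Q\<close> are all contained in the maximal
  one among them; passing to it loses only \<open>Q\<close> in the count.\<close>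

lemma deep_Suc_subset:
  assumes "finite T" "laminar T"
  shows "deep T (Suc u) Q \<subseteq> (\<Union>P\<in>tops {P\<in>T. P \<subset> Q}. deep T u P)"
proof
  fix x assume x: "x \<in> deep T (Suc u) Q"
  let ?T = "{P\<in>T. P \<subset> Q}" and ?A = "{P\<in>T. x \<in> P \<and> P \<subseteq> Q}"
  have lam: "laminar ?T" by (rule laminar_subset[OF assms(2)]) auto
  have fin: "finite ?T" using assms(1) by simp
  have card: "u < card (?A - {Q})"
    using x by (auto simp: deep_def card_Diff_singleton_if)
  then have "?A - {Q} \<noteq> {}" by (intro notI) (simp only: card.empty not_less0)
  then obtain P0 where "P0 \<in> ?A - {Q}" unfolding ex_in_conv[symmetric] by (rule exE)
  then have P0: "P0 \<in> ?T" "x \<in> P0" by (simp_all add: psubset_eq)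
  then obtain R where R: "R \<in> tops ?T" "x \<in> R"
    using tops_above[OF fin P0(1)] P0(2) by (metis subsetD)
  have "?A - {Q} \<subseteq> {P\<in>T. x \<in> P \<and> P \<subseteq> R}"
  proof
    fix P assume P: "P \<in> ?A - {Q}"
    then obtain R' where R': "R' \<in> tops ?T" "P \<subseteq> R'"
      using tops_above[OF fin, of P] by (auto simp: psubset_eq)
    have "x \<in> R'" using P R'(2) by (simp add: subsetD)
    then have "R' = R" using R(2) by (rule tops_disjoint[OF lam R'(1) R(1)])
    then show "P \<in> {P\<in>T. x \<in> P \<and> P \<subseteq> R}" using P R'(2) by simp
  qed
  then have "card (?A - {Q}) \<le> card {P\<in>T. x \<in> P \<and> P \<subseteq> R}"
    using assms(1) by (intro card_mono) auto
  with card R show "x \<in> (\<Union>P\<in>tops ?T. deep T u P)"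
    by (auto simp: deep_def intro!: bexI[of _ R])
qed

text \<open>Each generation costs a factor \<open>\<Lambda>\<close>: the induction hypothesis applies to the maximal cubes properly
  inside \<open>Q\<close>, which are disjoint and have total measure at most \<open>\<Lambda> |Q|\<close>.\<close>

lemma emeasure_deep_le:
  assumes "finite T" "laminar T" "T \<subseteq> sets lebesgue" "sparse_family \<Lambda> T" "0 \<le> \<Lambda>" "Q \<in> T"
  shows "emeasure lebesgue (deep T u Q) \<le> ennreal (\<Lambda> ^ u) * emeasure lebesgue Q"
  using \<open>Q \<in> T\<close>
proof (induction u arbitrary: Q)
  case 0
  then show ?case using assms(3) by (auto simp: deep_def intro!: emeasure_mono)
next
  case (Suc u)
  let ?T = "{P\<in>T. P \<subset> Q}"
  have T: "finite ?T" "laminar ?T" "?T \<subseteq> sets lebesgue" "tops ?T \<subseteq> T"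
    using assms laminar_subset[OF assms(2), of ?T] tops_subset[of ?T] by auto
  have meas: "deep T u P \<in> sets lebesgue" if "P \<in> T" for P
    using deep_sets[of T lebesgue P u] assms that by auto
  have "emeasure lebesgue (deep T (Suc u) Q) \<le> emeasure lebesgue (\<Union>P\<in>tops ?T. deep T u P)"
    using T meas finite_subset[OF tops_subset T(1)] deep_Suc_subset[OF assms(1,2)]
    by (intro emeasure_mono sets.finite_UN) auto
  also have "\<dots> \<le> (\<Sum>P\<in>tops ?T. emeasure lebesgue (deep T u P))"
    using T meas finite_subset[OF tops_subset T(1)] by (intro emeasure_subadditive_finite) auto
  also have "\<dots> \<le> (\<Sum>P\<in>tops ?T. ennreal (\<Lambda> ^ u) * emeasure lebesgue P)"
    using T by (intro sum_mono Suc.IH) auto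
  also have "\<dots> = ennreal (\<Lambda> ^ u) * emeasure lebesgue (\<Union>?T)"
    using emeasure_Union_tops[OF T(1-3)] by (simp add: sum_distrib_left[symmetric])
  also have "\<dots> \<le> ennreal (\<Lambda> ^ u) * (ennreal \<Lambda> * emeasure lebesgue Q)"
    using assms(4) Suc.prems by (intro mult_left_mono) (auto simp: sparse_family_def)
  also have "\<dots> = ennreal (\<Lambda> ^ Suc u) * emeasure lebesgue Q"
    using assms(5) by (simp add: ennreal_mult mult_ac)
  finally show ?case .
qed

text \<open>The members of \<open>T\<close> in which \<open>x\<close> is not deep form a chain, and they are all counted in the largest of
  them, where at most \<open>u\<close> are counted.\<close>

lemma card_not_deep_le:
  assumes "finite T" "laminar T"
  shows "card {Q\<in>T. x \<in> Q - deep T u Q} \<le> u"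
proof (cases "{Q\<in>T. x \<in> Q - deep T u Q} = {}")
  case False
  let ?B = "{Q\<in>T. x \<in> Q - deep T u Q}"
  have "finite ?B" using assms(1) by simp
  from finite_has_maximal[OF this False]
  obtain Q where Q: "Q \<in> ?B" "\<forall>P\<in>?B. Q \<subseteq> P \<longrightarrow> Q = P"
    by (rule bexE)
  then have "?B \<subseteq> {P\<in>T. x \<in> P \<and> P \<subseteq> Q}"
    using laminar_comparable[OF assms(2)] by blast
  then have "card ?B \<le> card {P\<in>T. x \<in> P \<and> P \<subseteq> Q}"
    using assms(1) by (intro card_mono) auto
  also have "\<dots> \<le> u" using Q(1) by (auto simp: deep_def)
  finally show ?thesis .
next
  case True
  then show ?thesis by (simp only: card.empty)
qed

section \<open>Sparse packing\<close>

text \<open>The function \<open>h\<close> in the proof equals \<open>L Q\<close> on the part \<open>H Q\<close> of \<open>Q\<close> outside the smaller members of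
  \<open>T\<close>. Interposing the simple function \<open>h \<le> g\<close> allows \<open>g\<close> to be an arbitrary, possibly non-measurable,
  function.\<close>

lemma sparse_packing:
  fixes T :: "(real ^ 'n) set set"
  assumes T: "finite T" "laminar T" "\<And>Q. Q \<in> T \<Longrightarrow> cube Q"
    and sparse: "sparse_family \<Lambda> T" and \<Lambda>: "0 \<le> \<Lambda>" "\<Lambda> < 1"
    and L: "\<And>Q x. Q \<in> T \<Longrightarrow> x \<in> Q \<Longrightarrow> L Q \<le> g x"
  shows "ennreal (1 - \<Lambda>) * (\<Sum>Q\<in>T. emeasure lebesgue Q * L Q)
    \<le> (\<Sum>Q\<in>tops T. \<integral>\<^sup>+x\<in>Q. g x \<partial>lebesgue)"
proof -
  define H where "H Q = Q - \<Union>{P\<in>T. P \<subset> Q}" for Q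
  have U: "\<Union>{P\<in>T. P \<subset> Q} \<in> sets lebesgue" for Q
    using T by (intro sets.finite_Union) (auto intro: cube_sets)
  have H_sets: "H Q \<in> sets lebesgue" if "Q \<in> T" for Q
    unfolding H_def using cube_sets[OF T(3)[OF that]] U by blast
  have tops_sets: "R \<in> sets lebesgue" if "R \<in> tops T" for R
    using T(3) tops_subset[of T] that by (auto intro: cube_sets)
  have H_unique: "P = Q" if "P \<in> T" "Q \<in> T" "x \<in> H P" "x \<in> H Q" for P Q x
    using laminar_comparable[OF T(2) that(1,2), of x] that unfolding H_def by blast
  have H_large: "ennreal (1 - \<Lambda>) * emeasure lebesgue Q \<le> emeasure lebesgue (H Q)" if "Q \<in> T" for Q
  proof -
    note Q = T(3)[OF that]
    have V: "emeasure lebesgue (\<Union>{P\<in>T. P \<subset> Q}) \<le> ennreal (\<Lambda> * measure lebesgue Q)"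
      using sparse that \<Lambda> by (auto simp: sparse_family_def cube_emeasure[OF Q] ennreal_mult)
    have "emeasure lebesgue (H Q)
        = ennreal (measure lebesgue Q) - emeasure lebesgue (\<Union>{P\<in>T. P \<subset> Q})"
      unfolding H_def using V U cube_sets[OF Q]
      by (subst emeasure_Diff) (auto simp: cube_emeasure[OF Q] top_unique)
    also have "\<dots> \<ge> ennreal (measure lebesgue Q) - ennreal (\<Lambda> * measure lebesgue Q)"
      using V by (rule ennreal_minus_mono[OF order_refl])
    also have "ennreal (measure lebesgue Q) - ennreal (\<Lambda> * measure lebesgue Q)
        = ennreal (1 - \<Lambda>) * emeasure lebesgue Q"
      using \<Lambda> by (simp add: ennreal_minus cube_emeasure[OF Q] algebra_simps flip: ennreal_mult)
    finally show ?thesis .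
  qed
  define h where "h x = (\<Sum>Q\<in>T. L Q * indicator (H Q) x)" for x
  have [measurable]: "h \<in> borel_measurable lebesgue"
    unfolding h_def using H_sets by (intro borel_measurable_sum) auto
  have h_le: "h x \<le> g x" if "x \<in> \<Union>T" for x
  proof (cases "\<exists>Q\<in>T. x \<in> H Q")
    case True
    then obtain Q where Q: "Q \<in> T" "x \<in> H Q" by blast
    have "h x = (\<Sum>P\<in>{Q}. L P * indicator (H P) x)"
      unfolding h_def using Q T(1) H_unique
      by (intro sum.mono_neutral_right) (auto simp: indicator_def)
    also have "\<dots> \<le> g x" using Q L[of Q x] by (auto simp: H_def)
    finally show ?thesis .
  qed (auto simp: h_def)
  have "ennreal (1 - \<Lambda>) * (\<Sum>Q\<in>T. emeasure lebesgue Q * L Q)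
      = (\<Sum>Q\<in>T. L Q * (ennreal (1 - \<Lambda>) * emeasure lebesgue Q))"
    by (simp add: sum_distrib_left mult_ac)
  also have "\<dots> \<le> (\<Sum>Q\<in>T. L Q * emeasure lebesgue (H Q))"
    by (intro sum_mono mult_left_mono H_large) auto
  also have "\<dots> = (\<integral>\<^sup>+x. h x \<partial>lebesgue)"
    unfolding h_def using H_sets by (subst nn_integral_sum) (auto simp: nn_integral_cmult_indicator)
  also have "\<dots> \<le> (\<integral>\<^sup>+x. (\<Sum>R\<in>tops T. h x * indicator R x) \<partial>lebesgue)"
  proof (rule nn_integral_mono)
    fix x
    show "h x \<le> (\<Sum>R\<in>tops T. h x * indicator R x)"
    proof (cases "x \<in> \<Union>T")
      case True
      then obtain R where R: "R \<in> tops T" "x \<in> R"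
        by (meson T(1) UnionE subsetD tops_above)
      then have "h x = h x * indicator R x" by simp
      also have "\<dots> \<le> (\<Sum>R\<in>tops T. h x * indicator R x)"
        using R finite_subset[OF tops_subset T(1)] by (intro member_le_sum) auto
      finally show ?thesis .
    next
      case False
      then have "h x = 0" by (auto simp: h_def H_def intro!: sum.neutral)
      then show ?thesis by simp
    qed
  qed
  also have "\<dots> = (\<Sum>R\<in>tops T. \<integral>\<^sup>+x\<in>R. h x \<partial>lebesgue)"
    using tops_sets by (subst nn_integral_sum) auto
  also have "\<dots> \<le> (\<Sum>R\<in>tops T. \<integral>\<^sup>+x\<in>R. g x \<partial>lebesgue)"
    using h_le tops_subset[of T]
    by (intro sum_mono nn_integral_mono) (auto simp: indicator_def)
  finally show ?thesis .
qed

text \<open>The scaling factor in \<open>frac_average \<alpha> f Q\<close> may be moved to the integral of \<open>g\<close>, where it yields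
  \<open>frac_average \<alpha> g Q\<close>, a lower bound for the maximal function on \<open>Q\<close>.\<close>

lemma sum_frac_average_le_frac_maximal:
  fixes f g :: "real ^ 'n \<Rightarrow> ennreal"
  assumes "finite T" and cubes: "\<And>Q. Q \<in> T \<Longrightarrow> cube Q"
    and disj: "\<And>P Q x. P \<in> T \<Longrightarrow> Q \<in> T \<Longrightarrow> x \<in> P \<Longrightarrow> x \<in> Q \<Longrightarrow> P = Q"
    and [measurable]: "f \<in> borel_measurable lebesgue"
  shows "(\<Sum>Q\<in>T. frac_average \<alpha> f Q * (\<integral>\<^sup>+x\<in>Q. g x \<partial>lebesgue))
    \<le> (\<integral>\<^sup>+x. f x * frac_maximal \<alpha> g x \<partial>lebesgue)"
proof -
  have "(\<Sum>Q\<in>T. frac_average \<alpha> f Q * (\<integral>\<^sup>+x\<in>Q. g x \<partial>lebesgue))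
      = (\<Sum>Q\<in>T. \<integral>\<^sup>+x. frac_average \<alpha> g Q * (f x * indicator Q x) \<partial>lebesgue)"
  proof (rule sum.cong)
    fix Q assume "Q \<in> T"
    then have [measurable]: "Q \<in> sets lebesgue" by (intro cube_sets cubes)
    show "frac_average \<alpha> f Q * (\<integral>\<^sup>+x\<in>Q. g x \<partial>lebesgue)
        = (\<integral>\<^sup>+x. frac_average \<alpha> g Q * (f x * indicator Q x) \<partial>lebesgue)"
      by (subst nn_integral_cmult) (measurable, simp add: frac_average_def mult_ac)
  qed simp
  also have "\<dots> = (\<integral>\<^sup>+x. (\<Sum>Q\<in>T. frac_average \<alpha> g Q * (f x * indicator Q x)) \<partial>lebesgue)"
    using cubes by (intro nn_integral_sum[symmetric]) (auto intro!: borel_measurable_times_ennreal borel_measurable_indicator cube_sets)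
  also have "\<dots> \<le> (\<integral>\<^sup>+x. f x * frac_maximal \<alpha> g x \<partial>lebesgue)"
  proof (rule nn_integral_mono)
    fix x
    show "(\<Sum>Q\<in>T. frac_average \<alpha> g Q * (f x * indicator Q x)) \<le> f x * frac_maximal \<alpha> g x"
    proof (cases "\<exists>Q\<in>T. x \<in> Q")
      case True
      then obtain Q where Q: "Q \<in> T" "x \<in> Q" by blast
      have "(\<Sum>Q\<in>T. frac_average \<alpha> g Q * (f x * indicator Q x))
          = (\<Sum>Q\<in>{Q}. frac_average \<alpha> g Q * (f x * indicator Q x))"
        using Q disj \<open>finite T\<close> by (intro sum.mono_neutral_right) (auto simp: indicator_def)
      also have "\<dots> = f x * frac_average \<alpha> g Q" using Q by (simp add: mult_ac)
      also have "\<dots> \<le> f x * frac_maximal \<alpha> g x"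
        unfolding frac_maximal_def using Q cubes by (intro mult_left_mono SUP_upper) auto
      finally show ?thesis .
    next
      case False
      then have "(\<Sum>Q\<in>T. frac_average \<alpha> g Q * (f x * indicator Q x)) = 0"
        by (intro sum.neutral) auto
      then show ?thesis by simp
    qed
  qed
  finally show ?thesis .
qed

lemma sparse_family_subset:
  assumes "sparse_family \<Lambda> S" "T \<subseteq> S" "countable S" "\<And>Q. Q \<in> S \<Longrightarrow> cube Q"
  shows "sparse_family \<Lambda> T"
  unfolding sparse_family_def
proof
  fix Q assume "Q \<in> T"
  have "emeasure lebesgue (\<Union>{P\<in>T. P \<subset> Q}) \<le> emeasure lebesgue (\<Union>{P\<in>S. P \<subset> Q})"
    using assms
    by (intro emeasure_mono sets.countable_Union) (auto intro: cube_sets countable_subset[OF _ assms(3)])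
  also have "\<dots> \<le> ennreal \<Lambda> * emeasure lebesgue Q"
    using assms \<open>Q \<in> T\<close> by (auto simp: sparse_family_def)
  finally show "emeasure lebesgue (\<Union>{P\<in>T. P \<subset> Q}) \<le> ennreal \<Lambda> * emeasure lebesgue Q" .
qed

text \<open>The lower bound \<open>b\<close> on the averages is spent only on the maximal cubes. Thus no part of \<open>f\<close> is used
  twice, although \<open>f\<close> may be concentrated on the small cubes of \<open>T\<close>.\<close>

lemma sum_luxemburg_le_integral:
  fixes T :: "(real ^ 'n) set set"
  assumes T: "finite T" "laminar T" "\<And>Q. Q \<in> T \<Longrightarrow> cube Q"
    and sparse: "sparse_family \<Lambda> T" and \<Lambda>: "0 \<le> \<Lambda>" "\<Lambda> < 1"
    and f: "f \<in> borel_measurable lebesgue"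
    and b: "0 \<le> b" "\<And>Q. Q \<in> T \<Longrightarrow> ennreal b \<le> frac_average \<alpha> f Q"
  shows "ennreal (b * (1 - \<Lambda>)) * (\<Sum>Q\<in>T. emeasure lebesgue Q * luxemburg \<phi> w Q)
    \<le> (\<integral>\<^sup>+x. f x * frac_maximal \<alpha> (maximal_young \<phi> w) x \<partial>lebesgue)"
proof -
  have "ennreal (b * (1 - \<Lambda>)) * (\<Sum>Q\<in>T. emeasure lebesgue Q * luxemburg \<phi> w Q)
      = ennreal b * (ennreal (1 - \<Lambda>) * (\<Sum>Q\<in>T. emeasure lebesgue Q * luxemburg \<phi> w Q))"
    using b(1) \<Lambda> by (simp add: ennreal_mult mult.assoc)
  also have "\<dots> \<le> ennreal b * (\<Sum>Q\<in>tops T. \<integral>\<^sup>+x\<in>Q. maximal_young \<phi> w x \<partial>lebesgue)"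
    using T(3) by (intro mult_left_mono sparse_packing[OF T sparse \<Lambda>])
      (auto simp: maximal_young_def intro!: SUP_upper)
  also have "\<dots> \<le> (\<Sum>Q\<in>tops T. frac_average \<alpha> f Q * (\<integral>\<^sup>+x\<in>Q. maximal_young \<phi> w x \<partial>lebesgue))"
    unfolding sum_distrib_left using b(2) tops_subset[of T]
    by (intro sum_mono mult_right_mono) auto
  also have "\<dots> \<le> (\<integral>\<^sup>+x. f x * frac_maximal \<alpha> (maximal_young \<phi> w) x \<partial>lebesgue)"
    using T tops_subset[of T] f
    by (intro sum_frac_average_le_frac_maximal finite_subset[OF tops_subset T(1)])
      (auto dest: tops_disjoint[OF T(2)])
  finally show ?thesis .
qed

section \<open>The weak type bound for finite families\<close>

lemma sum_half_powers_le:
  assumes "finite J" "J \<subseteq> {j0..}"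
  shows "(\<Sum>j\<in>J. (1 / 2) ^ j) \<le> 2 * (1 / 2 :: real) ^ j0"
proof -
  have "(\<Sum>j\<in>J. (1 / 2 :: real) ^ j) = (\<Sum>j\<in>J. (1 / 2) ^ j0 * (1 / 2) ^ (j - j0))"
    using assms(2) by (intro sum.cong) (auto simp flip: power_add)
  also have "\<dots> = (1 / 2) ^ j0 * (\<Sum>k\<in>(\<lambda>j. j - j0) ` J. (1 / 2) ^ k)"
    using assms(2) by (subst sum.reindex) (auto simp: sum_distrib_left intro!: inj_on_diff_nat)
  also have "(\<Sum>k\<in>(\<lambda>j. j - j0) ` J. (1 / 2 :: real) ^ k) \<le> (\<Sum>k. (1 / 2) ^ k)"
    using assms(1) by (intro sum_le_suminf) (auto intro: summable_geometric)
  also have "(\<Sum>k. (1 / 2 :: real) ^ k) = 2"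
    by (simp add: suminf_geometric)
  finally show ?thesis by (simp add: mult.commute)
qed

text \<open>Here \<open>n\<close> is the least number with \<open>r / 4 ^ Suc n < a\<close>.\<close>

lemma dyadic_level_exists:
  fixes a r :: real
  assumes "0 < a" "a \<le> r / 4 ^ j0" "0 < r"
  shows "\<exists>n\<ge>j0. r / 4 ^ Suc n < a \<and> a \<le> r / 4 ^ n"
proof -
  define P where "P n \<longleftrightarrow> r / 4 ^ Suc n < a" for n
  have "\<exists>n. P n"
  proof -
    obtain n where "r / a < 4 ^ n" using real_arch_pow[of 4 "r / a"] by auto
    also have "(4 :: real) ^ n \<le> 4 ^ Suc n" by simp
    finally show ?thesis
      unfolding P_def using assms by (intro exI[of _ n]) (simp add: field_simps)
  qed
  then have n: "P (LEAST n. P n)" and least: "\<And>k. P k \<Longrightarrow> (LEAST n. P n) \<le> k"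
    by (auto intro: LeastI_ex Least_le)
  define n where "n = (LEAST n. P n)"
  have "j0 \<le> n"
  proof (rule ccontr)
    assume "\<not> j0 \<le> n"
    then have "r / 4 ^ j0 \<le> r / 4 ^ Suc n"
      using assms(3) by (intro divide_left_mono power_increasing) auto
    with n assms(2) show False by (simp add: P_def n_def)
  qed
  moreover have "a \<le> r / 4 ^ n"
  proof (cases n)
    case 0
    with \<open>j0 \<le> n\<close> assms(2) show ?thesis by simp
  next
    case (Suc k)
    then have "\<not> P k" using least[of k] by (auto simp: n_def)
    with Suc show ?thesis by (simp add: P_def)
  qed
  ultimately show ?thesis using n by (auto simp: P_def n_def)
qed

lemma c_young_term_nonneg:
  assumes "young_function \<phi>" "filterlim (\<lambda>t. \<phi> t / t) at_top at_top"
  shows "0 \<le> c_young_term \<phi> k"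
  using young_inv_complementary(1)[OF assms, of "2 ^ 2 ^ k"] by (simp add: c_young_term_def)

lemma sum_c_young_term_le:
  assumes "young_function \<phi>" "filterlim (\<lambda>t. \<phi> t / t) at_top at_top"
    and "summable (\<lambda>k. c_young_term \<phi> (Suc k))" "finite J" "0 \<notin> J"
  shows "(\<Sum>j\<in>J. c_young_term \<phi> j) \<le> c_young \<phi>"
proof -
  have "(\<Sum>j\<in>J. c_young_term \<phi> j) = (\<Sum>k\<in>(\<lambda>j. j - 1) ` J. c_young_term \<phi> (Suc k))"
  proof (subst sum.reindex)
    show "inj_on (\<lambda>j. j - 1) J"
      using assms(5) by (intro inj_onI) (metis Suc_pred' neq0_conv)
    show "(\<Sum>j\<in>J. c_young_term \<phi> j) = sum ((\<lambda>k. c_young_term \<phi> (Suc k)) \<circ> (\<lambda>j. j - 1)) J"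
      using assms(5) by (intro sum.cong refl) (metis One_nat_def Suc_pred' comp_apply neq0_conv)
  qed
  also have "\<dots> \<le> c_young \<phi>"
    unfolding c_young_def using assms
    by (intro sum_le_suminf) (auto intro: c_young_term_nonneg)
  finally show ?thesis .
qed

lemma frac_average_finite:
  fixes f :: "real ^ 'n \<Rightarrow> real"
  assumes "nonneg_loc_integrable f" "cube Q"
  shows "frac_average \<alpha> (\<lambda>y. ennreal (f y)) Q < \<infinity>"
  using cube_integral_finite[OF assms] by (simp add: frac_average_def ennreal_mult_less_top)

lemma ennreal_mult_eqI:
  "0 \<le> a \<Longrightarrow> 0 \<le> b \<Longrightarrow> 0 \<le> c \<Longrightarrow> 0 \<le> d \<Longrightarrow> a * b = c * d \<Longrightarrow>
    ennreal a * ennreal b = ennreal c * ennreal d"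
  by (metis ennreal_mult)

lemma superlevel_sets:
  fixes F :: "(real ^ 'n) set set" and c :: "(real ^ 'n) set \<Rightarrow> ennreal"
  assumes "\<And>Q. Q \<in> F \<Longrightarrow> cube Q"
  shows "{x. ennreal r < (\<Sum>Q\<in>F. c Q * indicator Q x)} \<in> sets lebesgue"
proof -
  have [measurable]: "(\<lambda>x. \<Sum>Q\<in>F. c Q * indicator Q x) \<in> borel_measurable lebesgue"
    using assms by (intro borel_measurable_sum borel_measurable_times_ennreal
      borel_measurable_indicator borel_measurable_const cube_sets)
  have "{x \<in> space lebesgue. ennreal r < (\<Sum>Q\<in>F. c Q * indicator Q x)} \<in> sets lebesgue"
    by measurable
  then show ?thesis by simp
qed

text \<open>The cubes are sorted by \<open>lev\<close>. At level \<open>j\<close> there are at most \<open>m 2^j\<close> cubes in which \<open>x\<close> is not deep,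
  each with \<open>a Q \<le> r / 4^j\<close>; the geometric series of the bounds \<open>r m / 2^j\<close> over \<open>j \<ge> j0\<close> is at most
  \<open>2 r m / 2^j0 \<le> r / 2\<close>.\<close>

lemma near_sum_le:
  fixes a :: "'a set \<Rightarrow> real"
  assumes F: "finite F" "laminar F"
    and a: "\<And>Q. Q \<in> F \<Longrightarrow> a Q \<le> r / 4 ^ lev Q" "\<And>Q. Q \<in> F \<Longrightarrow> j0 \<le> lev Q" and "0 < r"
    and m: "real m * 4 \<le> 2 ^ j0"
  shows "(\<Sum>Q\<in>F. a Q * indicator (Q - deep {P\<in>F. lev P = lev Q} (m * 2 ^ lev Q) Q) x) \<le> r / 2"
proof -
  let ?T = "\<lambda>j. {P\<in>F. lev P = j}"
  have level: "(\<Sum>Q\<in>?T j. a Q * indicator (Q - deep (?T (lev Q)) (m * 2 ^ lev Q) Q) x)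
      \<le> r * real m * (1 / 2) ^ j" for j
  proof -
    let ?B = "{Q\<in>?T j. x \<in> Q - deep (?T j) (m * 2 ^ j) Q}"
    have "(\<Sum>Q\<in>?T j. a Q * indicator (Q - deep (?T (lev Q)) (m * 2 ^ lev Q) Q) x)
        = (\<Sum>Q\<in>?B. a Q)"
      using F(1) by (intro sum.mono_neutral_cong_right) (auto simp: indicator_def)
    also have "\<dots> \<le> of_nat (card ?B) * (r / 4 ^ j)"
      using a(1) by (intro sum_bounded_above) auto
    also have "\<dots> \<le> of_nat (m * 2 ^ j) * (r / 4 ^ j)"
      using F \<open>0 < r\<close> laminar_subset[OF F(2), of "?T j"]
      by (intro mult_right_mono of_nat_mono card_not_deep_le) auto
    also have "\<dots> = r * real m * (2 ^ j / (2 * 2) ^ j)" by simp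
    also have "\<dots> = r * real m * (1 / 2) ^ j"
      unfolding power_mult_distrib by (simp add: power_one_over)
    finally show ?thesis .
  qed
  have "(\<Sum>Q\<in>F. a Q * indicator (Q - deep (?T (lev Q)) (m * 2 ^ lev Q) Q) x)
      = (\<Sum>j\<in>lev ` F. \<Sum>Q\<in>?T j. a Q * indicator (Q - deep (?T (lev Q)) (m * 2 ^ lev Q) Q) x)"
    by (rule sum.image_gen[OF F(1)])
  also have "\<dots> \<le> (\<Sum>j\<in>lev ` F. r * real m * (1 / 2) ^ j)"
    by (intro sum_mono level)
  also have "\<dots> \<le> r * real m * (2 * (1 / 2) ^ j0)"
    unfolding sum_distrib_left[symmetric] using F(1) a(2) \<open>0 < r\<close>
    by (intro mult_left_mono sum_half_powers_le) auto
  also have "\<dots> \<le> r / 2"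
    using m \<open>0 < r\<close> by (simp add: power_one_over field_simps)
  finally show ?thesis .
qed

text \<open>The constant is \<open>5 * 4 ^ j0 / (1 - \<Lambda>)\<close> from the cubes with large average, where
  \<open>weight_le_luxemburg\<close> is applied to \<open>E = Q\<close> with \<open>K = 4 = 2 ^ 2 ^ 1\<close>, the argument of the first term of the
  series, and \<open>16 / (1 - \<Lambda>)\<close> from the deep parts: a factor \<open>2\<close> from Chebyshev's inequality at height
  \<open>r / 2\<close>, a factor \<open>1 + K = 2\<close>, and the ratio \<open>4\<close> of the bounds for the averages at one level.\<close>

lemma finite_weak_type:
  fixes F :: "(real ^ 'n) set set" and f w :: "real ^ 'n \<Rightarrow> real"
  assumes \<phi>: "young_function \<phi>" "filterlim (\<lambda>t. \<phi> t / t) at_top at_top"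
    and summable: "summable (\<lambda>k. c_young_term \<phi> (Suc k))"
    and F: "finite F" "laminar F" "\<And>Q. Q \<in> F \<Longrightarrow> cube Q" "sparse_family \<Lambda> F"
    and \<Lambda>: "0 < \<Lambda>" "\<Lambda> < 1"
    and w: "nonneg_loc_integrable w" and f: "nonneg_loc_integrable f" and r: "0 < r"
    and m: "\<Lambda> ^ m \<le> 1 / 2" and j0: "1 \<le> j0" "real m * 4 \<le> 2 ^ j0"
  shows "ennreal r * weight_of w
      {x. ennreal r < (\<Sum>Q\<in>F. frac_average \<alpha> (\<lambda>y. ennreal (f y)) Q * indicator Q x)}
    \<le> ennreal ((5 * 4 ^ j0 + 16) / (1 - \<Lambda>) * c_young \<phi>) *
      (\<integral>\<^sup>+x. ennreal (f x) * frac_maximal \<alpha> (maximal_young \<phi> w) x \<partial>lebesgue)"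
    (is "ennreal r * weight_of w ?G \<le> ennreal (?C * _) * ?I")
proof -
  note [measurable] = loc_integrable_measurable[OF w] loc_integrable_measurable[OF f]
  define a where "a Q = enn2real (frac_average \<alpha> (\<lambda>y. ennreal (f y)) Q)" for Q
  have a: "frac_average \<alpha> (\<lambda>y. ennreal (f y)) Q = ennreal (a Q)" if "Q \<in> F" for Q
    using frac_average_finite[OF f F(3)[OF that]] by (simp add: a_def less_top)
  have a0: "0 \<le> a Q" for Q by (simp add: a_def)
  define B where "B = {Q\<in>F. r / 4 ^ j0 < a Q}"
  define F' where "F' = {Q\<in>F. 0 < a Q \<and> a Q \<le> r / 4 ^ j0}"
  have "\<forall>Q\<in>F'. \<exists>n\<ge>j0. r / 4 ^ Suc n < a Q \<and> a Q \<le> r / 4 ^ n"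
    using dyadic_level_exists r by (auto simp: F'_def)
  then obtain lev where lev: "\<And>Q. Q \<in> F' \<Longrightarrow> j0 \<le> lev Q"
      "\<And>Q. Q \<in> F' \<Longrightarrow> r / 4 ^ Suc (lev Q) < a Q" "\<And>Q. Q \<in> F' \<Longrightarrow> a Q \<le> r / 4 ^ lev Q"
    by metis
  define T where "T j = {Q\<in>F'. lev Q = j}" for j
  define D where "D Q = deep (T (lev Q)) (m * 2 ^ lev Q) Q" for Q
  have sub: "B \<subseteq> F" "F' \<subseteq> F" "T j \<subseteq> F" for j
    by (auto simp: B_def F'_def T_def)
  have props: "finite T'" "laminar T'" "\<And>Q. Q \<in> T' \<Longrightarrow> cube Q" "sparse_family \<Lambda> T'"
    if "T' \<subseteq> F" for T'
    using that F finite_subset laminar_subset countable_finite[OF F(1)]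
      sparse_family_subset[OF F(4) that _ F(3)] by auto
  have D_sets [measurable]: "D Q \<in> sets lebesgue" if "Q \<in> F'" for Q
    unfolding D_def using props[OF sub(3)] that sub F(3)
    by (intro deep_sets) (auto intro!: cube_sets)
  \<comment> \<open>Chebyshev's inequality in pointwise form: outside the cubes of \<open>B\<close>, which have a large average,
    the deep parts contribute at least \<open>r / 2\<close>.\<close>
  have point: "ennreal r * indicator ?G x
      \<le> (\<Sum>Q\<in>B. ennreal r * indicator Q x) + (\<Sum>Q\<in>F'. ennreal (2 * a Q) * indicator (D Q) x)" for x
  proof (cases "x \<in> ?G")
    case True
    show ?thesis
    proof (cases "\<exists>Q\<in>B. x \<in> Q")
      case True
      then obtain Q where Q: "Q \<in> B" "x \<in> Q" by blast
      have "ennreal r * indicator ?G x \<le> ennreal r * indicator Q x"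
        using Q by (auto simp: indicator_def)
      also have "\<dots> \<le> (\<Sum>Q\<in>B. ennreal r * indicator Q x)"
        using Q props(1)[OF sub(1)] by (intro member_le_sum) auto
      finally show ?thesis by (rule add_increasing2[rotated]) simp
    next
      case False
      have "(\<Sum>Q\<in>F. frac_average \<alpha> (\<lambda>y. ennreal (f y)) Q * indicator Q x)
          = (\<Sum>Q\<in>F. ennreal (a Q * indicator Q x))"
        by (intro sum.cong) (auto simp: a indicator_def)
      also have "\<dots> = ennreal (\<Sum>Q\<in>F. a Q * indicator Q x)"
        by (intro sum_ennreal) (auto simp: a0)
      finally have "ennreal r < ennreal (\<Sum>Q\<in>F. a Q * indicator Q x)" using True by simp
      then have "r < (\<Sum>Q\<in>F. a Q * indicator Q x)"
        using r by (simp add: ennreal_less_iff)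
      also have "\<dots> = (\<Sum>Q\<in>F'. a Q * indicator Q x)"
      proof (rule sum.mono_neutral_right[OF F(1) sub(2)], rule ballI)
        fix Q assume Q: "Q \<in> F - F'"
        show "a Q * indicator Q x = 0"
        proof (cases "x \<in> Q")
          case True
          then have "Q \<notin> B" using False by blast
          then have "a Q = 0" using Q a0[of Q] by (auto simp: B_def F'_def)
          then show ?thesis by simp
        qed simp
      qed
      also have "\<dots> = (\<Sum>Q\<in>F'. a Q * indicator (Q - D Q) x) + (\<Sum>Q\<in>F'. a Q * indicator (D Q) x)"
        unfolding sum.distrib[symmetric]
        by (intro sum.cong) (auto simp: indicator_def D_def deep_def)
      also have "(\<Sum>Q\<in>F'. a Q * indicator (Q - D Q) x) \<le> r / 2"
        unfolding D_def T_def
        using lev r j0(2) props[OF sub(2)] by (intro near_sum_le[where ?j0.0 = j0]) auto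
      finally have "r \<le> (\<Sum>Q\<in>F'. 2 * a Q * indicator (D Q) x)"
        by (simp add: sum_distrib_left[symmetric] mult.assoc)
      then have "ennreal r \<le> ennreal (\<Sum>Q\<in>F'. 2 * a Q * indicator (D Q) x)"
        by (rule ennreal_leI)
      also have "\<dots> = (\<Sum>Q\<in>F'. ennreal (2 * a Q * indicator (D Q) x))"
        by (intro sum_ennreal[symmetric]) (auto simp: a0)
      also have "\<dots> = (\<Sum>Q\<in>F'. ennreal (2 * a Q) * indicator (D Q) x)"
        by (intro sum.cong) (auto simp: indicator_def)
      finally show ?thesis using True by (simp add: add_increasing)
    qed
  qed simp
  have "ennreal r * weight_of w ?G = (\<integral>\<^sup>+x. ennreal (w x) * (ennreal r * indicator ?G x) \<partial>lebesgue)"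
  proof -
    have "?G \<in> sets lebesgue" by (rule superlevel_sets[OF F(3)])
    then have "(\<lambda>x. ennreal (w x) * indicator ?G x) \<in> borel_measurable lebesgue"
      by (intro borel_measurable_times_ennreal borel_measurable_indicator) measurable
    then show ?thesis
      unfolding weight_of_def mult.left_commute[of _ "ennreal r"] by (rule nn_integral_cmult[symmetric])
  qed
  also have "\<dots> \<le> (\<integral>\<^sup>+x. ennreal (w x) * ((\<Sum>Q\<in>B. ennreal r * indicator Q x)
      + (\<Sum>Q\<in>F'. ennreal (2 * a Q) * indicator (D Q) x)) \<partial>lebesgue)"
    by (intro nn_integral_mono mult_left_mono point) simp
  also have "\<dots> = (\<integral>\<^sup>+x. (\<Sum>Q\<in>B. ennreal r * (ennreal (w x) * indicator Q x))
      + (\<Sum>Q\<in>F'. ennreal (2 * a Q) * (ennreal (w x) * indicator (D Q) x)) \<partial>lebesgue)"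
    by (simp add: distrib_left sum_distrib_left mult_ac)
  also have "\<dots> = (\<Sum>Q\<in>B. ennreal r * weight_of w Q) + (\<Sum>Q\<in>F'. ennreal (2 * a Q) * weight_of w (D Q))"
  proof -
    have B_sets: "Q \<in> sets lebesgue" if "Q \<in> B" for Q
      using props(3)[OF sub(1)] that by (auto intro: cube_sets)
    show ?thesis
      unfolding weight_of_def using B_sets D_sets
      by (subst nn_integral_add) (auto simp: nn_integral_sum nn_integral_cmult
        intro!: borel_measurable_sum borel_measurable_times_ennreal)
  qed
  also have "\<dots> \<le> ennreal (5 * 4 ^ j0 / (1 - \<Lambda>) * c_young \<phi>) * ?I
      + ennreal (16 / (1 - \<Lambda>) * c_young \<phi>) * ?I"
  proof (rule add_mono)
    define t where "t = c_young_term \<phi> 1"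
    have t: "0 \<le> t" "t \<le> c_young \<phi>"
      using c_young_term_nonneg[OF \<phi>, of 1] sum_c_young_term_le[OF \<phi> summable, of "{1}"]
      by (auto simp: t_def)
    have wQ: "weight_of w Q \<le> ennreal (5 * t) * (emeasure lebesgue Q * luxemburg \<phi> w Q)"
      if "Q \<in> B" for Q
    proof -
      have s: "0 < young_inv (complementary \<phi>) 4"
        "complementary \<phi> (young_inv (complementary \<phi>) 4) = 4"
        using young_inv_complementary[OF \<phi>, of 4] by auto
      have "cube Q" using that props(3)[OF sub(1)] by blast
      then show ?thesis
        using weight_le_luxemburg[OF \<phi> w _ _ _ s(1), of Q Q 4] s
        by (simp add: cube_sets t_def c_young_term_def)
    qed
    have "(\<Sum>Q\<in>B. ennreal r * weight_of w Q)
        \<le> (\<Sum>Q\<in>B. ennreal r * (ennreal (5 * t) * (emeasure lebesgue Q * luxemburg \<phi> w Q)))"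
      by (intro sum_mono mult_left_mono wQ) auto
    also have "\<dots> = ennreal (5 * 4 ^ j0 / (1 - \<Lambda>) * t) * (ennreal (r / 4 ^ j0 * (1 - \<Lambda>)) *
        (\<Sum>Q\<in>B. emeasure lebesgue Q * luxemburg \<phi> w Q))"
    proof -
      have "ennreal r * ennreal (5 * t)
          = ennreal (5 * 4 ^ j0 / (1 - \<Lambda>) * t) * ennreal (r / 4 ^ j0 * (1 - \<Lambda>))"
        using r \<Lambda> t by (intro ennreal_mult_eqI) auto
      then show ?thesis by (simp only: sum_distrib_left mult.assoc[symmetric])
    qed
    also have "\<dots> \<le> ennreal (5 * 4 ^ j0 / (1 - \<Lambda>) * t) * ?I"
      using \<Lambda> r a by (intro mult_left_mono sum_luxemburg_le_integral props[OF sub(1)])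
        (auto simp: B_def intro!: ennreal_leI)
    also have "\<dots> \<le> ennreal (5 * 4 ^ j0 / (1 - \<Lambda>) * c_young \<phi>) * ?I"
      using \<Lambda> t by (intro mult_right_mono ennreal_leI mult_left_mono) auto
    finally show "(\<Sum>Q\<in>B. ennreal r * weight_of w Q)
        \<le> ennreal (5 * 4 ^ j0 / (1 - \<Lambda>) * c_young \<phi>) * ?I" .
  next
    have level: "(\<Sum>Q\<in>T j. ennreal (2 * a Q) * weight_of w (D Q))
        \<le> ennreal (16 / (1 - \<Lambda>) * c_young_term \<phi> j) * ?I" for j
    proof -
      define s where "s = young_inv (complementary \<phi>) (2 ^ 2 ^ j)"
      have s: "0 < s" "complementary \<phi> s = 2 ^ 2 ^ j"
        using young_inv_complementary[OF \<phi>, of "2 ^ 2 ^ j"] by (auto simp: s_def)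
      have wD: "weight_of w (D Q) \<le> ennreal (2 / s) * (emeasure lebesgue Q * luxemburg \<phi> w Q)"
        if Q: "Q \<in> T j" for Q
      proof -
        have "Q \<in> F'" "lev Q = j" using Q by (auto simp: T_def)
        have "ennreal (complementary \<phi> s) * emeasure lebesgue (D Q)
            \<le> ennreal (2 ^ 2 ^ j) * (ennreal (\<Lambda> ^ (m * 2 ^ j)) * emeasure lebesgue Q)"
          unfolding s(2) D_def \<open>lev Q = j\<close> using props[OF sub(3)[of j]] \<Lambda> Q
          by (intro mult_left_mono emeasure_deep_le) (auto intro: cube_sets)
        also have "\<dots> = ennreal (2 ^ 2 ^ j * (\<Lambda> ^ m) ^ 2 ^ j) * emeasure lebesgue Q"
          using \<Lambda> by (simp add: ennreal_mult power_mult mult.assoc)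
        also have "\<dots> \<le> ennreal 1 * emeasure lebesgue Q"
        proof (intro mult_right_mono ennreal_leI)
          have "2 ^ 2 ^ j * (\<Lambda> ^ m) ^ 2 ^ j = (2 * \<Lambda> ^ m) ^ 2 ^ j" by (simp add: power_mult_distrib)
          also have "\<dots> \<le> 1" using m \<Lambda> by (intro power_le_one) auto
          finally show "2 ^ 2 ^ j * (\<Lambda> ^ m) ^ 2 ^ j \<le> 1" .
        qed simp
        finally show ?thesis
          using weight_le_luxemburg[OF \<phi> w _ _ _ s(1), of Q "D Q" 1] s(2) Q \<open>Q \<in> F'\<close>
            props(3)[OF sub(3)[of j]] D_sets
          by (auto simp: D_def deep_def)
      qed
      have "(\<Sum>Q\<in>T j. ennreal (2 * a Q) * weight_of w (D Q))
          \<le> (\<Sum>Q\<in>T j. ennreal (2 * (r / 4 ^ j)) * (ennreal (2 / s) * (emeasure lebesgue Q * luxemburg \<phi> w Q)))"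
        using lev(3) a0 by (intro sum_mono mult_mono wD ennreal_leI) (auto simp: T_def)
      also have "\<dots> = ennreal (16 / (1 - \<Lambda>) * c_young_term \<phi> j) * (ennreal (r / 4 ^ Suc j * (1 - \<Lambda>)) *
          (\<Sum>Q\<in>T j. emeasure lebesgue Q * luxemburg \<phi> w Q))"
      proof -
        have "ennreal (2 * (r / 4 ^ j)) * ennreal (2 / s)
            = ennreal (16 / (1 - \<Lambda>) * (1 / s)) * ennreal (r / 4 ^ Suc j * (1 - \<Lambda>))"
          using r \<Lambda> s by (intro ennreal_mult_eqI) auto
        then show ?thesis
          by (simp only: sum_distrib_left mult.assoc[symmetric] c_young_term_def s_def[symmetric])
      qed
      also have "\<dots> \<le> ennreal (16 / (1 - \<Lambda>) * c_young_term \<phi> j) * ?I"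
      proof (intro mult_left_mono sum_luxemburg_le_integral props[OF sub(3)])
        fix Q assume "Q \<in> T j"
        then have "Q \<in> F'" "lev Q = j" by (auto simp: T_def)
        then show "ennreal (r / 4 ^ Suc j) \<le> frac_average \<alpha> (\<lambda>y. ennreal (f y)) Q"
          using lev(2)[of Q] a[OF subsetD[OF sub(2)], of Q] by (simp add: ennreal_leI)
      qed (use \<Lambda> r in auto)
      finally show ?thesis .
    qed
    have "finite F'" using props(1)[OF sub(2)] .
    have "(\<Sum>Q\<in>F'. ennreal (2 * a Q) * weight_of w (D Q))
        = (\<Sum>j\<in>lev ` F'. \<Sum>Q\<in>T j. ennreal (2 * a Q) * weight_of w (D Q))"
      unfolding T_def by (rule sum.image_gen[OF \<open>finite F'\<close>])
    also have "\<dots> \<le> (\<Sum>j\<in>lev ` F'. ennreal (16 / (1 - \<Lambda>) * c_young_term \<phi> j) * ?I)"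
      by (intro sum_mono level)
    also have "\<dots> = (\<Sum>j\<in>lev ` F'. ennreal (16 / (1 - \<Lambda>) * c_young_term \<phi> j)) * ?I"
      by (rule sum_distrib_right[symmetric])
    also have "(\<Sum>j\<in>lev ` F'. ennreal (16 / (1 - \<Lambda>) * c_young_term \<phi> j))
        = ennreal (\<Sum>j\<in>lev ` F'. 16 / (1 - \<Lambda>) * c_young_term \<phi> j)"
      using \<Lambda> c_young_term_nonneg[OF \<phi>] by (intro sum_ennreal) auto
    also have "ennreal (\<Sum>j\<in>lev ` F'. 16 / (1 - \<Lambda>) * c_young_term \<phi> j) * ?I
        \<le> ennreal (16 / (1 - \<Lambda>) * c_young \<phi>) * ?I"
      unfolding sum_distrib_left[symmetric] using \<Lambda> lev(1) j0(1) \<open>finite F'\<close>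
      by (intro mult_right_mono ennreal_leI mult_left_mono sum_c_young_term_le[OF \<phi> summable]) fastforce+
    finally show "(\<Sum>Q\<in>F'. ennreal (2 * a Q) * weight_of w (D Q))
        \<le> ennreal (16 / (1 - \<Lambda>) * c_young \<phi>) * ?I" .
  qed
  also have "\<dots> = ennreal (?C * c_young \<phi>) * ?I"
  proof -
    have "0 \<le> c_young \<phi>" using sum_c_young_term_le[OF \<phi> summable, of "{}"] by simp
    then have "ennreal (5 * 4 ^ j0 / (1 - \<Lambda>) * c_young \<phi>) + ennreal (16 / (1 - \<Lambda>) * c_young \<phi>)
        = ennreal (?C * c_young \<phi>)"
      using \<Lambda> by (simp add: add_divide_distrib distrib_right flip: ennreal_plus)
    then show ?thesis by (simp only: distrib_right[symmetric])
  qed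
  finally show ?thesis .
qed

section \<open>Dyadic grids and infinite families\<close>

lemma dyadic_grid_cube: "dyadic_grid D \<Longrightarrow> Q \<in> D \<Longrightarrow> cube Q"
  by (auto simp: dyadic_grid_def)

lemma dyadic_grid_laminar: "dyadic_grid D \<Longrightarrow> laminar D"
  by (simp add: dyadic_grid_def laminar_def)

text \<open>The cubes of one generation are disjoint and have interior points.\<close>

lemma dyadic_grid_countable:
  fixes D :: "(real ^ 'n) set set"
  assumes D: "dyadic_grid D"
  shows "countable D"
proof -
  let ?D = "\<lambda>k::int. {Q\<in>D. measure lebesgue Q = 2 powi (k * int CARD('n))}"
  have "countable (?D k)" for k
  proof (rule countable_disjoint_nonempty_interior_subsets)
    show "pairwise disjnt (?D k)"
      using D by (auto simp: dyadic_grid_def partition_on_def)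
    show "Q = {}" if "Q \<in> ?D k" "interior Q = {}" for Q
      using that cube_interior_nonempty[OF dyadic_grid_cube[OF D]] by blast
  qed
  then have "countable (\<Union>k. ?D k)"
    by (intro countable_UN) auto
  moreover have "D \<subseteq> (\<Union>k. ?D k)"
    using D by (auto simp: dyadic_grid_def)
  ultimately show ?thesis by (rule countable_subset[rotated])
qed

lemma sum_powr_le_powr_sum:
  fixes a :: "'b \<Rightarrow> real"
  assumes "finite A" "\<And>i. i \<in> A \<Longrightarrow> 0 \<le> a i" "1 \<le> p"
  shows "(\<Sum>i\<in>A. a i powr p) \<le> (\<Sum>i\<in>A. a i) powr p"
proof -
  let ?s = "\<Sum>i\<in>A. a i"
  have split: "x powr p = x * x powr (p - 1)" if "0 \<le> x" for x :: real
    using that powr_add[of x 1 "p - 1"] by (cases "x = 0") auto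
  have "(\<Sum>i\<in>A. a i powr p) \<le> (\<Sum>i\<in>A. a i * ?s powr (p - 1))"
  proof (rule sum_mono)
    fix i assume i: "i \<in> A"
    then have "a i \<le> ?s" using assms by (intro member_le_sum) auto
    then have "a i * a i powr (p - 1) \<le> a i * ?s powr (p - 1)"
      using i assms by (intro mult_left_mono powr_mono2) auto
    then show "a i powr p \<le> a i * ?s powr (p - 1)"
      using split assms(2)[OF i] by simp
  qed
  also have "\<dots> = ?s powr p"
    using split[of ?s] assms by (simp add: sum_distrib_right[symmetric] sum_nonneg)
  finally show ?thesis .
qed

text \<open>This reduces the operator to finite sums and, at the same time, the exponent \<open>\<nu>\<close> to \<open>1\<close>.\<close>

lemma sparse_operator_finite_subfamily:
  fixes f :: "real ^ 'n \<Rightarrow> real"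
  assumes f: "nonneg_loc_integrable f" and S: "\<And>Q. Q \<in> S \<Longrightarrow> cube Q"
    and \<nu>: "1 \<le> \<nu>" and r: "0 < r" "ennreal r < sparse_operator \<alpha> \<nu> S f x"
  obtains F where "finite F" "F \<subseteq> S"
    "ennreal r < (\<Sum>Q\<in>F. frac_average \<alpha> (\<lambda>y. ennreal (f y)) Q * indicator Q x)"
proof -
  let ?avg = "frac_average \<alpha> (\<lambda>y. ennreal (f y))"
  define a where "a Q = enn2real (?avg Q)" for Q
  have a: "?avg Q = ennreal (a Q)" if "Q \<in> S" for Q
    using frac_average_finite[OF f S[OF that]] by (simp add: a_def less_top)
  have a0: "0 \<le> a Q" for Q by (simp add: a_def)
  define U where "U = (\<Sum>\<^sub>\<infinity>Q\<in>S. ennreal_power (?avg Q) \<nu> * indicator Q x)"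
  have op: "sparse_operator \<alpha> \<nu> S f x = ennreal_power U (1 / \<nu>)"
    by (simp only: sparse_operator_def U_def)
  have "ennreal (r powr \<nu>) < U"
  proof (cases U)
    case (real u)
    have "ennreal r < ennreal (u powr (1 / \<nu>))"
      using r(2) real unfolding op by (simp add: ennreal_power_def)
    then have "r < u powr (1 / \<nu>)" using r(1) by (simp add: ennreal_less_iff)
    then have "r powr \<nu> < (u powr (1 / \<nu>)) powr \<nu>"
      using r(1) \<nu> by (intro powr_less_mono2) auto
    then show ?thesis using real \<nu> by (simp add: powr_powr ennreal_less_iff)
  qed simp
  also have "U = (SUP F\<in>{F. finite F \<and> F \<subseteq> S}. \<Sum>Q\<in>F. ennreal_power (?avg Q) \<nu> * indicator Q x)"
    unfolding U_def by (rule nonneg_infsum_complete) simp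
  finally obtain F where F: "finite F" "F \<subseteq> S"
    "ennreal (r powr \<nu>) < (\<Sum>Q\<in>F. ennreal_power (?avg Q) \<nu> * indicator Q x)"
    unfolding less_SUP_iff by blast
  have "(\<Sum>Q\<in>F. ennreal_power (?avg Q) \<nu> * indicator Q x)
      = (\<Sum>Q\<in>F. ennreal ((a Q * indicator Q x) powr \<nu>))"
  proof (rule sum.cong)
    fix Q assume "Q \<in> F"
    then have "ennreal_power (?avg Q) \<nu> = ennreal (a Q powr \<nu>)"
      using F(2) a[of Q] a0[of Q] by (auto simp: ennreal_power_def)
    then show "ennreal_power (?avg Q) \<nu> * indicator Q x = ennreal ((a Q * indicator Q x) powr \<nu>)"
      by (simp add: indicator_def)
  qed simp
  also have "\<dots> = ennreal (\<Sum>Q\<in>F. (a Q * indicator Q x) powr \<nu>)"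
    by (rule sum_ennreal) simp
  finally have "r powr \<nu> < (\<Sum>Q\<in>F. (a Q * indicator Q x) powr \<nu>)"
    using F(3) by (simp add: ennreal_less_iff)
  also have "\<dots> \<le> (\<Sum>Q\<in>F. a Q * indicator Q x) powr \<nu>"
    using F(1) \<nu> a0 by (intro sum_powr_le_powr_sum) auto
  finally have less: "r powr \<nu> < (\<Sum>Q\<in>F. a Q * indicator Q x) powr \<nu>" .
  have "r < (\<Sum>Q\<in>F. a Q * indicator Q x)"
  proof (rule ccontr)
    assume "\<not> ?thesis"
    then have "(\<Sum>Q\<in>F. a Q * indicator Q x) powr \<nu> \<le> r powr \<nu>"
      using \<nu> a0 by (intro powr_mono2 sum_nonneg) auto
    with less show False by simp
  qed
  then have "ennreal r < ennreal (\<Sum>Q\<in>F. a Q * indicator Q x)"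
    using r(1) by (simp add: ennreal_less_iff)
  also have "\<dots> = (\<Sum>Q\<in>F. ennreal (a Q * indicator Q x))"
    using a0 by (intro sum_ennreal[symmetric]) auto
  also have "\<dots> = (\<Sum>Q\<in>F. ?avg Q * indicator Q x)"
    using F(2) a by (intro sum.cong) (auto simp: indicator_def)
  finally show ?thesis using F that by blast
qed

lemma countable_exhaustion:
  assumes "countable S"
  shows "\<exists>F :: nat \<Rightarrow> 'a set. incseq F \<and> (\<forall>n. finite (F n) \<and> F n \<subseteq> S) \<and>
    (\<forall>A. finite A \<and> A \<subseteq> S \<longrightarrow> (\<exists>n. A \<subseteq> F n))"
proof -
  let ?F = "\<lambda>n. {Q\<in>S. to_nat_on S Q \<le> n}"
  have fin: "finite (?F n)" for n
  proof (rule finite_imageD)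
    show "finite (to_nat_on S ` ?F n)" by (rule finite_subset[of _ "{..n}"]) auto
    show "inj_on (to_nat_on S) (?F n)"
      using inj_on_to_nat_on[OF assms] by (rule inj_on_subset) auto
  qed
  have "\<exists>n. A \<subseteq> ?F n" if "finite A" "A \<subseteq> S" for A
    using that by (intro exI[of _ "Max (to_nat_on S ` A)"]) auto
  with fin show ?thesis
    by (intro exI[of _ ?F]) (simp add: incseq_def Collect_mono_iff)
qed

text \<open>The superlevel set is covered by the increasing union of the superlevel sets of finite subfamilies,
  to which \<open>finite_weak_type\<close> applies with the same constant.\<close>

lemma sparse_weak_type:
  fixes S :: "(real ^ 'n) set set" and f w :: "real ^ 'n \<Rightarrow> real"
  assumes \<phi>: "young_function \<phi>" "filterlim (\<lambda>t. \<phi> t / t) at_top at_top"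
    and summable: "summable (\<lambda>k. c_young_term \<phi> (Suc k))"
    and S: "countable S" "laminar S" "\<And>Q. Q \<in> S \<Longrightarrow> cube Q" "sparse_family \<Lambda> S"
    and \<Lambda>: "0 < \<Lambda>" "\<Lambda> < 1" and \<nu>: "1 \<le> \<nu>"
    and w: "nonneg_loc_integrable w" and f: "nonneg_loc_integrable f" and r: "0 < r"
    and m: "\<Lambda> ^ m \<le> 1 / 2" and j0: "1 \<le> j0" "real m * 4 \<le> 2 ^ j0"
  shows "ennreal r * weight_of w {x. ennreal r < sparse_operator \<alpha> \<nu> S f x}
    \<le> ennreal ((5 * 4 ^ j0 + 16) / (1 - \<Lambda>) * c_young \<phi>) *
      (\<integral>\<^sup>+x. ennreal (f x) * frac_maximal \<alpha> (maximal_young \<phi> w) x \<partial>lebesgue)"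
    (is "_ \<le> ?R")
proof -
  obtain F where F: "incseq F" "\<And>n. finite (F n)" "\<And>n. F n \<subseteq> S"
      "\<And>A. finite A \<Longrightarrow> A \<subseteq> S \<Longrightarrow> \<exists>n. A \<subseteq> F n"
    using countable_exhaustion[OF S(1)] by metis
  let ?avg = "frac_average \<alpha> (\<lambda>y. ennreal (f y))"
  define E where "E n = {x. ennreal r < (\<Sum>Q\<in>F n. ?avg Q * indicator Q x)}" for n
  have sum_mono_F: "(\<Sum>Q\<in>A. ?avg Q * indicator Q x) \<le> (\<Sum>Q\<in>F n. ?avg Q * indicator Q x)"
    if "A \<subseteq> F n" for A n x
    using F(2) that by (intro sum_mono2) auto
  have E_inc: "incseq E"
    unfolding E_def using F(1) by (auto simp: incseq_def intro: less_le_trans[OF _ sum_mono_F])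
  have E_sets: "E n \<in> sets lebesgue" for n
    unfolding E_def using F(3) S(3) by (intro superlevel_sets) auto
  let ?W = "density lebesgue (\<lambda>x. ennreal (w x))"
  have W: "weight_of w A = emeasure ?W A" if "A \<in> sets lebesgue" for A
    using that loc_integrable_measurable[OF w] by (simp add: weight_of_def emeasure_density)
  have "{x. ennreal r < sparse_operator \<alpha> \<nu> S f x} \<subseteq> (\<Union>n. E n)"
  proof
    fix x assume "x \<in> {x. ennreal r < sparse_operator \<alpha> \<nu> S f x}"
    then obtain A where A: "finite A" "A \<subseteq> S" "ennreal r < (\<Sum>Q\<in>A. ?avg Q * indicator Q x)"
      using sparse_operator_finite_subfamily[OF f S(3) \<nu> r] by blast
    with F(4) obtain n where "A \<subseteq> F n" by blast
    then show "x \<in> (\<Union>n. E n)"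
      unfolding E_def using less_le_trans[OF A(3) sum_mono_F] by blast
  qed
  then have "weight_of w {x. ennreal r < sparse_operator \<alpha> \<nu> S f x} \<le> weight_of w (\<Union>n. E n)"
    unfolding weight_of_def by (intro nn_integral_mono) (auto simp: indicator_def)
  also have "\<dots> = (SUP n. weight_of w (E n))"
  proof -
    have "(SUP n. emeasure ?W (E n)) = emeasure ?W (\<Union>n. E n)"
      using E_inc E_sets by (intro SUP_emeasure_incseq) auto
    then show ?thesis using E_sets by (simp add: W sets.countable_UN)
  qed
  finally have "ennreal r * weight_of w {x. ennreal r < sparse_operator \<alpha> \<nu> S f x}
      \<le> ennreal r * (SUP n. weight_of w (E n))"
    by (rule mult_left_mono) simp
  also have "\<dots> = (SUP n. ennreal r * weight_of w (E n))"
    by (rule SUP_mult_left_ennreal)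
  also have "\<dots> \<le> ?R"
  proof (rule SUP_least)
    fix n
    have "cube Q" if "Q \<in> F n" for Q using that F(3) S(3) by blast
    then show "ennreal r * weight_of w (E n) \<le> ?R"
      unfolding E_def
      by (intro finite_weak_type[OF \<phi> summable F(2) _ _ _ \<Lambda> w f r m j0]
          laminar_subset[OF S(2) F(3)] sparse_family_subset[OF S(4) F(3) S(1,3)]) auto
  qed
  finally show ?thesis .
qed

theorem theorem1p1:
  fixes \<alpha> \<nu> \<Lambda>\<^sub>0 :: real and N :: nat
  assumes "0 \<le> \<alpha>" and "\<alpha> < real CARD('n::finite)"
    and "1 \<le> \<nu>"
    and "0 < \<Lambda>\<^sub>0" and "\<Lambda>\<^sub>0 < 1"
  shows "\<exists>C::real. 0 < C \<and>
    (\<forall>\<phi>. young_function \<phi> \<and> filterlim (\<lambda>t. \<phi> t / t) at_top at_top \<and>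
         summable (\<lambda>k. c_young_term \<phi> (Suc k)) \<longrightarrow>
      (\<forall>(D :: (real ^ 'n) set set) S w f.
         dyadic_grid D \<and> S \<subseteq> D \<and> sparse_family \<Lambda>\<^sub>0 S \<and> regular_family N S \<and>
         nonneg_loc_integrable w \<and> nonneg_loc_integrable f \<longrightarrow>
         (SUP r\<in>{0<..}. ennreal r * weight_of w {x. ennreal r < sparse_operator \<alpha> \<nu> S f x})
           \<le> ennreal (C * c_young \<phi>) *
             (\<integral>\<^sup>+x. ennreal (f x) * frac_maximal \<alpha> (maximal_young \<phi> w) x \<partial>lebesgue)))"
proof -
  obtain m where m: "\<Lambda>\<^sub>0 ^ m < 1 / 2"
    using real_arch_pow_inv[of "1 / 2" \<Lambda>\<^sub>0] assms by auto
  \<comment> \<open>\<open>j0 = Suc j\<close> is positive, as the series defining \<open>c_young\<close> starts at index \<open>1\<close>.\<close>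
  obtain j where "real m * 4 < 2 ^ j"
    using real_arch_pow[of 2 "real m * 4"] by auto
  also have "(2 :: real) ^ j \<le> 2 ^ Suc j" by simp
  finally have j: "real m * 4 \<le> 2 ^ Suc j" by simp
  let ?C = "(5 * 4 ^ Suc j + 16) / (1 - \<Lambda>\<^sub>0)"
  have "0 < ?C" using assms by (intro divide_pos_pos add_nonneg_pos) auto
  moreover have "(SUP r\<in>{0<..}. ennreal r * weight_of w {x. ennreal r < sparse_operator \<alpha> \<nu> S f x})
      \<le> ennreal (?C * c_young \<phi>) *
        (\<integral>\<^sup>+x. ennreal (f x) * frac_maximal \<alpha> (maximal_young \<phi> w) x \<partial>lebesgue)"
    if "young_function \<phi>" "filterlim (\<lambda>t. \<phi> t / t) at_top at_top"
      "summable (\<lambda>k. c_young_term \<phi> (Suc k))" and D: "dyadic_grid D" "S \<subseteq> D"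
      and "sparse_family \<Lambda>\<^sub>0 S" "nonneg_loc_integrable w" "nonneg_loc_integrable f"
    for \<phi> w f and D S :: "(real ^ 'n) set set"
    using that assms m j dyadic_grid_cube[OF D(1)]
      countable_subset[OF D(2) dyadic_grid_countable[OF D(1)]]
      laminar_subset[OF dyadic_grid_laminar[OF D(1)] D(2)]
    by (intro SUP_least sparse_weak_type) auto
  ultimately show ?thesis by blast
qed

end
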